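(* Let $G$ be a directed graph on vertex set $[n]$ (no loops, multiple edges allowed), and write $$\omega X_G(\mathbf x;q)=\sum_{\alpha\vDash n}c^G_\alpha(q)\frac{\Psi_\alpha(\mathbf x)}{z_\alpha}.$$ Then $c^G_\alpha(q)\in\mathbb N[q]$ (polynomials with nonnegative integer coefficients) for every composition $\alpha$.
   Context: A coloring of $G$ is a map $\kappa:[n]\to\mathbb Z_{>0}$; it is proper if the endpoints of every edge get different colors. $\mathrm{asc}(\kappa)$ is the number of directed edges $(i,j)$ (counted with multiplicity) with $\kappa(i)<\kappa(j)$. The chromatic quasisymmetric function is $X_G(\mathbf x;q)=\sum_{\kappa\text{ proper}}x_{\kappa(1)}\cdots x_{\kappa(n)}q^{\mathrm{asc}(\kappa)}$. $F_{n,S}$ ($S\subseteq[n-1]$) is the fundamental quasisymmetric function $\sum x_{j_1}\cdots x_{j_n}$ over $j_1\le\dots\le j_n$ with $j_i<j_{i+1}$ for $i\in S$; $\omega$ is the linear automorphism with $\omega(F_{n,S})=F_{n,[n-1]\setminus(n-S)}$, $n-S=\{n-s:s\in S\}$, extended coefficientwise in $q$. For compositions: $S_\alpha=\{\alpha_1,\dots,\alpha_1+\dots+\alpha_{\ell-1}\}$, blocks $B_i(\alpha)$ consecutive intervals of sizes $\alpha_i$, $\alpha\le\beta$ iff $S_\beta\subseteq S_\alpha$; $M_\alpha=\sum_{i_1<\dots<i_\ell}x_{i_1}^{\alpha_1}\cdots x_{i_\ell}^{\alpha_\ell}$; $z_\alpha=\prod_i i^{m_i}m_i!$; $\pi(\gamma)=\prod_i(\gamma_1+\dots+\gamma_i)$;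 $\pi(\alpha,\beta)=\prod_i\pi(\alpha^{(i)})$ with $\alpha^{(i)}$ the parts of $\alpha$ whose blocks lie in $B_i(\beta)$; $\Psi_\alpha=z_\alpha\sum_{\beta\ge\alpha}\pi(\alpha,\beta)^{-1}M_\beta$. *)

theory Defs
  imports Main "HOL-Library.Multiset" "HOL-Computational_Algebra.Polynomial"
begin

text \<open>Formal power series in the variables x_1, x_2, ... with coefficients in Q[q] are
represented by their coefficient functions: an exponent vector e :: nat => nat
(e c = exponent of x_c) is mapped to a coefficient in rat poly.
A directed graph on [n] (no loops, multiple edges allowed) is a multiset of pairs (i,j).\<close>

type_synonym qseries = "(nat \<Rightarrow> nat) \<Rightarrow> rat poly"

definition seqs :: "nat \<Rightarrow> (nat \<Rightarrow> nat) set" where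
  "seqs n = {j. (\<forall>i. i \<notin> {1..n} \<longrightarrow> j i = 0) \<and> (\<forall>i\<in>{1..n}. 0 < j i)}"

definition monomial_of :: "nat \<Rightarrow> (nat \<Rightarrow> nat) \<Rightarrow> (nat \<Rightarrow> nat)" where
  "monomial_of n j = (\<lambda>c. card {i\<in>{1..n}. j i = c})"

definition proper :: "(nat \<times> nat) multiset \<Rightarrow> (nat \<Rightarrow> nat) \<Rightarrow> bool" where
  "proper E \<kappa> \<longleftrightarrow> (\<forall>(i,j)\<in>#E. \<kappa> i \<noteq> \<kappa> j)"

definition asc :: "(nat \<times> nat) multiset \<Rightarrow> (nat \<Rightarrow> nat) \<Rightarrow> nat" where
  "asc E \<kappa> = size (filter_mset (\<lambda>(i,j). \<kappa> i < \<kappa> j) E)"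

definition XG :: "nat \<Rightarrow> (nat \<times> nat) multiset \<Rightarrow> qseries" where
  "XG n E e = (\<Sum>\<kappa>\<in>{\<kappa>\<in>seqs n. proper E \<kappa> \<and> monomial_of n \<kappa> = e}. monom 1 (asc E \<kappa>))"

definition qsF :: "nat \<Rightarrow> nat set \<Rightarrow> qseries" where
  "qsF n S e = of_nat (card {j\<in>seqs n. (\<forall>i\<in>{1..<n}. j i \<le> j (Suc i) \<and> (i \<in> S \<longrightarrow> j i < j (Suc i)))
                                   \<and> monomial_of n j = e})"

text \<open>The index set of omega(F_{n,S}) = F_{n,[n-1] - (n - S)}.\<close>
definition omega_set :: "nat \<Rightarrow> nat set \<Rightarrow> nat set" where
  "omega_set n S = {1..<n} - (\<lambda>s. n - s) ` S"

definition comps :: "nat \<Rightarrow> nat list set" where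
  "comps n = {\<alpha>. (\<forall>a\<in>set \<alpha>. 0 < a) \<and> sum_list \<alpha> = n}"

definition partial :: "nat list \<Rightarrow> nat \<Rightarrow> nat" where
  "partial \<alpha> k = sum_list (take k \<alpha>)"

definition Sset :: "nat list \<Rightarrow> nat set" where
  "Sset \<alpha> = {partial \<alpha> k | k. 0 < k \<and> k < length \<alpha>}"

definition qsM :: "nat list \<Rightarrow> qseries" where
  "qsM \<alpha> e = of_nat (card {i. (\<forall>k. length \<alpha> \<le> k \<longrightarrow> i k = 0) \<and> (\<forall>k<length \<alpha>. 0 < i k)
       \<and> (\<forall>k. Suc k < length \<alpha> \<longrightarrow> i k < i (Suc k))
       \<and> e = (\<lambda>c. \<Sum>k<length \<alpha>. if i k = c then \<alpha> ! k else 0)})"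

definition zee :: "nat list \<Rightarrow> rat" where
  "zee \<alpha> = (\<Prod>i\<in>set \<alpha>. of_nat (i ^ count (mset \<alpha>) i * fact (count (mset \<alpha>) i)))"

definition pi_list :: "nat list \<Rightarrow> rat" where
  "pi_list \<gamma> = (\<Prod>i<length \<gamma>. of_nat (sum_list (take (Suc i) \<gamma>)))"

text \<open>alpha^(i): parts of alpha whose blocks lie in the block B_i(beta) (i 0-indexed).
  Block k of alpha is {partial alpha k + 1 .. partial alpha (k+1)}.\<close>
definition subparts :: "nat list \<Rightarrow> nat list \<Rightarrow> nat \<Rightarrow> nat list" where
  "subparts \<alpha> \<beta> i = map (\<lambda>k. \<alpha> ! k)
     (filter (\<lambda>k. partial \<beta> i \<le> partial \<alpha> k \<and> partial \<alpha> (Suc k) \<le> partial \<beta> (Suc i)) [0..<length \<alpha>])"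

definition pi_pair :: "nat list \<Rightarrow> nat list \<Rightarrow> rat" where
  "pi_pair \<alpha> \<beta> = (\<Prod>i<length \<beta>. pi_list (subparts \<alpha> \<beta> i))"

text \<open>Power sum quasisymmetric function Psi_alpha (alpha a composition of n);
  beta ranges over compositions of n with alpha \<le> beta, i.e. S_beta \<subseteq> S_alpha.\<close>
definition Psi :: "nat \<Rightarrow> nat list \<Rightarrow> qseries" where
  "Psi n \<alpha> e = [: zee \<alpha> :] * (\<Sum>\<beta>\<in>{\<beta>\<in>comps n. Sset \<beta> \<subseteq> Sset \<alpha>}. [: 1 / pi_pair \<alpha> \<beta> :] * qsM \<beta> e)"

end

theory Submission
  imports Defs "HOL-Library.Product_Lexorder"
begin

text \<open>Group the proper colorings by the acyclic orientation R that they induce. For fixed R,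
choose an injective vertex labelling g that decreases along R. Sorting the vertices by
(color, g) attaches to every coloring one permutation; the colorings attached to a permutation
have generating function F indexed by its g-descent set, and a coloring is strictly increasing
along R iff its permutation is a linear extension of R. Reversing a permutation complements and
reflects its descent set, which is how \<open>\<omega>\<close> acts, and a coloring is weakly decreasing along R iff
its permutation is a linear extension of the converse of R. So \<open>\<omega>\<close> of the strict generating
function of R is the weak one of its converse.

For a poset P, the coefficient of \<open>\<Psi>_\<alpha> / z_\<alpha>\<close> in the weak generating function is the number of ways
to exhaust P from the top by removing principal filters of sizes \<open>\<alpha>_\<ell>, ..., \<alpha>_1\<close>. Comparing
coefficients of monomial functions, this reduces to a statement about one fibre U of a coloring:
the numbers of such exhaustions of U, weighted by \<open>1 / \<pi>(\<alpha>)\<close>, sum to 1. The last factor of \<open>\<pi>(\<alpha>)\<close> is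
|U|, which is also the number of choices of the first principal filter, so this follows by
induction.\<close>

subsection \<open>Exhausting a preorder by principal filters\<close>

definition up :: "('a \<Rightarrow> 'a \<Rightarrow> bool) \<Rightarrow> 'a set \<Rightarrow> 'a \<Rightarrow> 'a set" where
  "up r A x = {y \<in> A. r x y}"

definition upsets :: "('a \<Rightarrow> 'a \<Rightarrow> bool) \<Rightarrow> 'a set \<Rightarrow> 'a set set" where
  "upsets r A = {U. U \<subseteq> A \<and> (\<forall>x\<in>U. \<forall>y\<in>A. r x y \<longrightarrow> y \<in> U)}"

text \<open>The list is read from the top: its head is the size of the first filter removed, so for a
composition \<open>\<alpha>\<close> this is used with \<open>rev \<alpha>\<close>.\<close>
fun exhaustions :: "('a \<Rightarrow> 'a \<Rightarrow> bool) \<Rightarrow> nat list \<Rightarrow> 'a set \<Rightarrow> nat" where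
  "exhaustions r [] A = (if A = {} then 1 else 0)"
| "exhaustions r (a # \<gamma>) A = (\<Sum>x | x \<in> A \<and> card (up r A x) = a. exhaustions r \<gamma> (A - up r A x))"

lemma finite_upsets: "finite A \<Longrightarrow> finite (upsets r A)"
  by (rule finite_subset[of _ "Pow A"]) (auto simp: upsets_def)

lemma up_upset:
  assumes "U \<in> upsets r A" "x \<in> U"
  shows "up r U x = up r A x"
  using assms by (auto simp: up_def upsets_def)

text \<open>The filters removed for \<gamma> together form an upset \<open>U\<close>, whose
  principal filters agree with those of \<open>A\<close>; what follows is an exhaustion of
  \<open>A - U\<close>. So exhaustions are sorted by the set removed first.\<close>

lemma exhaustions_append:
  assumes "finite A" and r: "reflp r" "transp r"
  shows "exhaustions r (\<gamma> @ \<delta>) A =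
    (\<Sum>U | U \<in> upsets r A \<and> card U = sum_list \<gamma>. exhaustions r \<gamma> U * exhaustions r \<delta> (A - U))"
  using assms(1)
proof (induction \<gamma> arbitrary: A)
  case Nil
  have "{U. U \<in> upsets r A \<and> card U = sum_list []} = {{}}"
    using Nil finite_subset by (fastforce simp: upsets_def)
  then show ?case by simp
next
  case (Cons a \<gamma>)
  let ?X = "{x. x \<in> A \<and> card (up r A x) = a}"
  let ?Us = "{U. U \<in> upsets r A \<and> card U = a + sum_list \<gamma>}"
  let ?V = "\<lambda>x. {U. U \<in> upsets r (A - up r A x) \<and> card U = sum_list \<gamma>}"
  let ?Y = "\<lambda>U. {x. x \<in> U \<and> card (up r U x) = a}"
  let ?f = "\<lambda>x V. exhaustions r \<gamma> V * exhaustions r \<delta> (A - up r A x - V)"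
  let ?g = "\<lambda>U x. exhaustions r \<gamma> (U - up r U x) * exhaustions r \<delta> (A - U)"
  have finA: "finite A" by fact
  have finV: "finite (?V x)" for x
    using finite_upsets[of "A - up r A x" r] finA by simp
  have finU: "finite U" if "U \<in> ?Us" for U
    using that finA by (auto simp: upsets_def intro: finite_subset)
  have fin_Us: "finite ?Us"
    using finite_upsets[OF finA, of r] by simp
  have up_self: "x \<in> up r A x" if "x \<in> A" for x
    using that r(1) by (simp add: up_def reflp_def)
  have up_sub: "up r A x \<subseteq> A" for x
    by (auto simp: up_def)
  have "exhaustions r ((a # \<gamma>) @ \<delta>) A = (\<Sum>x\<in>?X. \<Sum>V\<in>?V x. ?f x V)"
    using finA by (auto intro!: sum.cong Cons.IH)
  also have "\<dots> = (\<Sum>(x, V)\<in>Sigma ?X ?V. ?f x V)"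
    using finA finV by (intro sum.Sigma) auto
  \<comment> \<open>Trade a first filter and an upset \<open>V\<close> of the remainder for the
    upset \<open>U = V \<union> up r A x\<close> with marked generator \<open>x\<close>.
    Transitivity makes \<open>U\<close> up-closed, reflexivity puts \<open>x\<close> in
    \<open>U\<close>, and removing the filter recovers \<open>V\<close>.\<close>
  also have "\<dots> = (\<Sum>(U, x)\<in>Sigma ?Us ?Y. ?g U x)"
  proof -
    have 1: "V \<union> up r A x - up r A x = V" "(V \<union> up r A x, x) \<in> Sigma ?Us ?Y"
      "?g (V \<union> up r A x) x = ?f x V" if "(x, V) \<in> Sigma ?X ?V" for x V
    proof -
      have x: "x \<in> A" "a = card (up r A x)"
        and V: "V \<in> upsets r (A - up r A x)" "card V = sum_list \<gamma>" using that by auto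
      have disj: "V \<inter> up r A x = {}" and "V \<subseteq> A" using V by (auto simp: upsets_def)
      have U: "V \<union> up r A x \<in> upsets r A"
        using V(1) r(2) by (auto simp: upsets_def up_def transp_def)
      show *: "V \<union> up r A x - up r A x = V" using disj by auto
      have "card (V \<union> up r A x) = card V + card (up r A x)"
        using disj \<open>V \<subseteq> A\<close> finA up_sub[of x] by (intro card_Un_disjoint) (auto intro: finite_subset)
      moreover have e: "up r (V \<union> up r A x) x = up r A x"
        using up_upset[OF U] up_self[OF x(1)] by auto
      ultimately show "(V \<union> up r A x, x) \<in> Sigma ?Us ?Y"
        using U V x up_self[OF x(1)] by auto
      have "A - (V \<union> up r A x) = A - up r A x - V" by auto
      then show "?g (V \<union> up r A x) x = ?f x V" using e * by simp
    qed
    have 2: "U - up r A x \<union> up r A x = U" "(x, U - up r A x) \<in> Sigma ?X ?V"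
      if "(U, x) \<in> Sigma ?Us ?Y" for U x
    proof -
      have U: "U \<in> upsets r A" "card U = a + sum_list \<gamma>" "x \<in> U" "card (up r U x) = a"
        using that by auto
      have UA: "U \<subseteq> A" using U by (auto simp: upsets_def)
      have e: "up r U x = up r A x" using up_upset[OF U(1,3)] .
      have sub: "up r A x \<subseteq> U" unfolding e[symmetric] by (auto simp: up_def)
      then show "U - up r A x \<union> up r A x = U" by auto
      have "card (U - up r A x) = card U - card (up r A x)"
        using sub UA finA by (intro card_Diff_subset) (auto intro: finite_subset)
      moreover have "U - up r A x \<in> upsets r (A - up r A x)"
        using U(1) by (auto simp: upsets_def)
      ultimately show "(x, U - up r A x) \<in> Sigma ?X ?V"
        using U UA e by auto
    qed
    show ?thesis
      apply (rule sum.reindex_bij_witness[where j = "\<lambda>(x, V). (V \<union> up r A x, x)"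
            and i = "\<lambda>(U, x). (x, U - up r A x)"])
      subgoal for p using 1(1)[of "fst p" "snd p"] by (simp only: prod.collapse case_prod_unfold fst_conv snd_conv)
      subgoal for p using 1(2)[of "fst p" "snd p"] by (simp only: prod.collapse case_prod_unfold fst_conv snd_conv)
      subgoal for p using 2(1)[of "fst p" "snd p"] by (simp only: prod.collapse case_prod_unfold fst_conv snd_conv)
      subgoal for p using 2(2)[of "fst p" "snd p"] by (simp only: prod.collapse case_prod_unfold fst_conv snd_conv)
      subgoal for p using 1(3)[of "fst p" "snd p"] by (simp only: prod.collapse case_prod_unfold fst_conv snd_conv)
      done
  qed
  also have "\<dots> = (\<Sum>U\<in>?Us. \<Sum>x\<in>?Y U. ?g U x)"
  proof (rule sum.Sigma[of ?Us ?Y ?g, symmetric, OF fin_Us], rule ballI)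
    fix U assume "U \<in> ?Us"
    then show "finite (?Y U)" using finU by (intro finite_Collect_conjI disjI1) (simp only: Collect_mem_eq)
  qed
  also have "\<dots> = (\<Sum>U\<in>?Us. exhaustions r (a # \<gamma>) U * exhaustions r \<delta> (A - U))"
    by (simp add: sum_distrib_right)
  finally show ?case by simp
qed

section \<open>Compositions and the total weight of the exhaustions of a fibre\<close>

lemma length_le_sum_list:
  "(\<forall>a\<in>set \<alpha>. 0 < a) \<Longrightarrow> length \<alpha> \<le> sum_list (\<alpha> :: nat list)"
  by (induction \<alpha>) auto

lemma finite_comps: "finite (comps n)"
proof (rule finite_subset)
  show "comps n \<subseteq> {xs. set xs \<subseteq> {..n} \<and> length xs \<le> n}"
    by (auto simp: comps_def length_le_sum_list member_le_sum_list)
qed (simp add: finite_lists_length_le)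

lemma comps_0: "comps 0 = {[]}"
  by (auto simp: comps_def) (metis list.set_intros(1) neq_Nil_conv less_irrefl)

text \<open>The split is at the last part, since \<open>rev\<close> makes it the first filter
  removed and its partial sum is the last factor of \<open>pi_list\<close>.\<close>

lemma comps_snoc:
  assumes "0 < m"
  shows "comps m = (\<lambda>(a, \<alpha>). \<alpha> @ [a]) ` (SIGMA a:{1..m}. comps (m - a))"
proof (intro equalityI subsetI)
  fix \<alpha> assume \<alpha>: "\<alpha> \<in> comps m"
  then obtain \<beta> a where [simp]: "\<alpha> = \<beta> @ [a]"
    using assms by (cases \<alpha> rule: rev_cases) (auto simp: comps_def)
  show "\<alpha> \<in> (\<lambda>(a, \<alpha>). \<alpha> @ [a]) ` (SIGMA a:{1..m}. comps (m - a))"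
    using \<alpha> by (intro image_eqI[of _ _ "(a, \<beta>)"]) (auto simp: comps_def)
qed (auto simp: comps_def)

lemma pi_list_snoc: "pi_list (\<alpha> @ [a]) = pi_list \<alpha> * of_nat (sum_list \<alpha> + a)"
  by (simp add: pi_list_def lessThan_Suc mult.commute)

text \<open>Strong induction on the size. Any element of \<open>U\<close> can generate the first
  filter, and the exhaustions of the remainder have weight 1 by induction. The last factor of
  \<open>pi_list\<close> is \<open>card U\<close>, so the total is \<open>card U\<close> terms
  \<open>1 / card U\<close>. Generators rather than filters are counted, which makes this exact for
  preorders too; reflexivity makes the remainder smaller.\<close>

lemma exhaustions_total:
  assumes "finite U" "reflp r"
  shows "(\<Sum>\<alpha>\<in>comps (card U). of_nat (exhaustions r (rev \<alpha>) U) / pi_list \<alpha>) = 1"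
  using assms(1)
proof (induction "card U" arbitrary: U rule: less_induct)
  case less
  show ?case
  proof (cases "U = {}")
    case True
    then show ?thesis by (simp add: comps_0 pi_list_def)
  next
    case False
    let ?m = "card U"
    let ?D = "\<lambda>x. U - up r U x"
    have m: "0 < ?m" using False less by (simp add: card_gt_0_iff)
    have up: "x \<in> up r U x" "up r U x \<subseteq> U" if "x \<in> U" for x
      using that assms(2) by (auto simp: up_def reflp_def)
    have cardD: "card (?D x) = ?m - card (up r U x)" "card (up r U x) \<in> {1..?m}" if "x \<in> U" for x
    proof -
      have f: "finite (up r U x)" using up(2)[OF that] less by (auto intro: finite_subset)
      show "card (?D x) = ?m - card (up r U x)"
        using card_Diff_subset[OF f up(2)[OF that]] .
      have "card (up r U x) \<noteq> 0" using f up(1)[OF that] by auto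
      then show "card (up r U x) \<in> {1..?m}"
        using card_mono[OF less.prems up(2)[OF that]] by simp
    qed
    let ?w = "\<lambda>x \<alpha>. of_nat (exhaustions r (rev \<alpha>) (?D x)) / pi_list \<alpha> :: rat"
    have "(\<Sum>\<alpha>\<in>comps ?m. of_nat (exhaustions r (rev \<alpha>) U) / pi_list \<alpha>)
      = (\<Sum>(a, \<alpha>)\<in>(SIGMA a:{1..?m}. comps (?m - a)).
           of_nat (exhaustions r (rev (\<alpha> @ [a])) U) / pi_list (\<alpha> @ [a]))"
      unfolding comps_snoc[OF m] by (subst sum.reindex) (auto simp: inj_on_def intro!: sum.cong)
    also have "\<dots> = (\<Sum>a\<in>{1..?m}. \<Sum>\<alpha>\<in>comps (?m - a).
           of_nat (exhaustions r (rev (\<alpha> @ [a])) U) / pi_list (\<alpha> @ [a]))"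
      by (rule sum.Sigma[symmetric]) (auto simp: finite_comps)
    also have "\<dots> = (\<Sum>a\<in>{1..?m}. \<Sum>x | x \<in> U \<and> card (up r U x) = a.
           (\<Sum>\<alpha>\<in>comps (?m - a). ?w x \<alpha>) / of_nat ?m)"
    proof (rule sum.cong[OF refl])
      fix a assume a: "a \<in> {1..?m}"
      have "(\<Sum>\<alpha>\<in>comps (?m - a). of_nat (exhaustions r (rev (\<alpha> @ [a])) U) / pi_list (\<alpha> @ [a]))
        = (\<Sum>\<alpha>\<in>comps (?m - a). \<Sum>x | x \<in> U \<and> card (up r U x) = a. ?w x \<alpha> / of_nat ?m)"
      proof (rule sum.cong[OF refl])
        fix \<alpha> assume "\<alpha> \<in> comps (?m - a)"
        then have "sum_list \<alpha> + a = ?m" using a by (simp add: comps_def)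
        then show "of_nat (exhaustions r (rev (\<alpha> @ [a])) U) / pi_list (\<alpha> @ [a])
          = (\<Sum>x | x \<in> U \<and> card (up r U x) = a. ?w x \<alpha> / of_nat ?m)"
          by (simp add: pi_list_snoc sum_divide_distrib del: of_nat_add)
      qed
      also have "\<dots> = (\<Sum>x | x \<in> U \<and> card (up r U x) = a. \<Sum>\<alpha>\<in>comps (?m - a). ?w x \<alpha> / of_nat ?m)"
        by (rule sum.swap)
      finally show "(\<Sum>\<alpha>\<in>comps (?m - a). of_nat (exhaustions r (rev (\<alpha> @ [a])) U) / pi_list (\<alpha> @ [a]))
        = (\<Sum>x | x \<in> U \<and> card (up r U x) = a. (\<Sum>\<alpha>\<in>comps (?m - a). ?w x \<alpha>) / of_nat ?m)"
        by (simp add: sum_divide_distrib)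
    qed
    also have "\<dots> = (\<Sum>a\<in>{1..?m}. \<Sum>x | x \<in> U \<and> card (up r U x) = a. 1 / of_nat ?m)"
    proof (intro sum.cong refl)
      fix a x assume a: "a \<in> {1..?m}" and x: "x \<in> {x. x \<in> U \<and> card (up r U x) = a}"
      have "(\<Sum>\<alpha>\<in>comps (card (?D x)). ?w x \<alpha>) = 1"
        using a x cardD[of x] less.prems by (intro less.hyps) auto
      then show "(\<Sum>\<alpha>\<in>comps (?m - a). ?w x \<alpha>) / of_nat ?m = 1 / of_nat ?m"
        using x cardD[of x] by auto
    qed
    \<comment> \<open>Every generator has a filter size in \<open>{1..?m}\<close>, so the sizes
      \<open>a\<close> partition \<open>U\<close>.\<close>
    also have "\<dots> = (\<Sum>x\<in>U. 1 / of_nat ?m)"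
      using less.prems cardD(2) by (intro sum.group) auto
    also have "\<dots> = 1" using m by simp
    finally show ?thesis .
  qed
qed

section \<open>Partial sums and refinement of compositions\<close>

text \<open>Unlike \<open>Sset\<close>, this keeps the end points 0 and the total, so that appending
  a part just inserts the new total.\<close>

definition partials :: "nat list \<Rightarrow> nat set" where
  "partials \<alpha> = partial \<alpha> ` {..length \<alpha>}"

lemma partial_append1: "k \<le> length \<alpha> \<Longrightarrow> partial (\<alpha> @ \<beta>) k = partial \<alpha> k"
  by (simp add: partial_def)

lemma partial_mono:
  assumes "k \<le> l" shows "partial \<alpha> k \<le> partial \<alpha> l"
proof -
  have "take l \<alpha> = take k \<alpha> @ drop k (take l \<alpha>)"
    using append_take_drop_id[of k "take l \<alpha>"] assms by (simp add: min_def)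
  then show ?thesis by (metis le_add1 partial_def sum_list_append)
qed

lemma partial_le: "partial \<alpha> k \<le> sum_list \<alpha>"
  by (metis append_take_drop_id le_add1 partial_def sum_list_append)

lemma partial_strict:
  assumes "\<forall>a\<in>set \<alpha>. 0 < a" "k < l" "l \<le> length \<alpha>"
  shows "partial \<alpha> k < partial \<alpha> l"
proof -
  have "partial \<alpha> (Suc k) = partial \<alpha> k + \<alpha> ! k"
    using assms by (simp add: partial_def take_Suc_conv_app_nth)
  then have "partial \<alpha> k < partial \<alpha> (Suc k)" using assms by simp
  also have "\<dots> \<le> partial \<alpha> l" using assms by (intro partial_mono) simp
  finally show ?thesis .
qed

lemma partials_Sset: 
  assumes "\<alpha> \<in> comps n"
  shows "partials \<alpha> = insert 0 (insert n (Sset \<alpha>))"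
proof -
  have "{..length \<alpha>} = insert 0 (insert (length \<alpha>) {k. 0 < k \<and> k < length \<alpha>})" by auto
  moreover have "partial \<alpha> 0 = 0" "partial \<alpha> (length \<alpha>) = n"
    using assms by (auto simp: partial_def comps_def)
  moreover have "partial \<alpha> ` {k. 0 < k \<and> k < length \<alpha>} = Sset \<alpha>" by (auto simp: Sset_def)
  ultimately show ?thesis by (simp add: partials_def)
qed

lemma Sset_bounds:
  assumes "\<alpha> \<in> comps n" "x \<in> Sset \<alpha>"
  shows "0 < x" "x < n"
proof -
  obtain k where k: "x = partial \<alpha> k" "0 < k" "k < length \<alpha>"
    using assms by (auto simp: Sset_def)
  have "partial \<alpha> 0 < x" "x < partial \<alpha> (length \<alpha>)"
    using assms k partial_strict[of \<alpha>] by (auto simp: comps_def)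
  then show "0 < x" "x < n" using assms by (auto simp: comps_def partial_def)
qed

lemma Sset_subset_iff:
  assumes "\<alpha> \<in> comps n" "\<beta> \<in> comps n"
  shows "Sset \<beta> \<subseteq> Sset \<alpha> \<longleftrightarrow> partials \<beta> \<subseteq> partials \<alpha>"
proof -
  have "0 \<notin> Sset \<beta>" "n \<notin> Sset \<beta>" using Sset_bounds[OF assms(2)] by blast+
  then show ?thesis using partials_Sset[OF assms(1)] partials_Sset[OF assms(2)] by auto
qed

text \<open>The \<alpha> with \<alpha> \<le> \<beta>, that is, those for which \<open>Psi\<close>
  has a term in \<open>qsM \<beta>\<close>.\<close>

definition refinements :: "nat list \<Rightarrow> nat list set" where
  "refinements \<beta> = {\<alpha> \<in> comps (sum_list \<beta>). Sset \<beta> \<subseteq> Sset \<alpha>}"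

lemma refinements_eq_partials:
  assumes "\<forall>b\<in>set \<beta>. 0 < b"
  shows "refinements \<beta> = {\<alpha> \<in> comps (sum_list \<beta>). partials \<beta> \<subseteq> partials \<alpha>}"
proof -
  have "\<beta> \<in> comps (sum_list \<beta>)" using assms by (simp add: comps_def)
  then show ?thesis unfolding refinements_def using Sset_subset_iff by blast
qed

lemma partials_snoc: "partials (\<beta> @ [b]) = insert (sum_list \<beta> + b) (partials \<beta>)"
proof -
  have "{..length (\<beta> @ [b])} = insert (Suc (length \<beta>)) {..length \<beta>}" by auto
  moreover have "partial (\<beta> @ [b]) ` {..length \<beta>} = partials \<beta>"
    unfolding partials_def by (intro image_cong) (auto simp: partial_append1)
  moreover have "partial (\<beta> @ [b]) (Suc (length \<beta>)) = sum_list \<beta> + b"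
    by (simp add: partial_def)
  ultimately show ?thesis by (simp only: partials_def[of "\<beta> @ [b]"] image_insert)
qed

text \<open>A refinement of \<open>\<beta> @ [b]\<close> has \<open>sum_list \<beta>\<close> among
  its partial sums. Cutting there leaves a refinement of \<beta> and an unrestricted composition of
  \<open>b\<close>, as the last block prescribes no inner cut.\<close>

lemma refinements_snoc:
  assumes pos: "\<forall>b\<in>set \<beta>. 0 < b" "0 < b"
  shows "refinements (\<beta> @ [b]) = (\<lambda>(\<alpha>, \<gamma>). \<alpha> @ \<gamma>) ` (refinements \<beta> \<times> comps b)"
proof (intro equalityI subsetI)
  let ?s = "sum_list \<beta>"
  fix \<alpha> assume "\<alpha> \<in> refinements (\<beta> @ [b])"
  then have \<alpha>: "\<alpha> \<in> comps (?s + b)" "partials (\<beta> @ [b]) \<subseteq> partials \<alpha>"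
    using refinements_eq_partials[of "\<beta> @ [b]"] pos by auto
  have "?s \<in> partials \<beta>" unfolding partials_def by (rule image_eqI[of _ _ "length \<beta>"]) (auto simp: partial_def)
  then have "?s \<in> partials \<alpha>" using \<alpha>(2) by (auto simp: partials_snoc)
  then obtain k where k: "?s = partial \<alpha> k" "k \<le> length \<alpha>"
    by (auto simp: partials_def)
  have sums: "sum_list (take k \<alpha>) = ?s" "sum_list (drop k \<alpha>) = b"
    using k(1) \<alpha>(1) arg_cong[OF append_take_drop_id[of k \<alpha>], of sum_list]
    by (auto simp: partial_def comps_def simp del: append_take_drop_id)
  have "partials \<beta> \<subseteq> partials (take k \<alpha>)"
  proof
    fix x assume x: "x \<in> partials \<beta>"
    then have "x \<le> ?s" by (auto simp: partials_def partial_le)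
    have "x \<in> partials \<alpha>" using x \<alpha>(2) by (auto simp: partials_snoc)
    then obtain l where l: "x = partial \<alpha> l" "l \<le> length \<alpha>"
      by (auto simp: partials_def)
    \<comment> \<open>If \<open>l\<close> exceeds \<open>k\<close>, monotonicity and
      \<open>x \<le> ?s\<close> force the partial sums at \<open>k\<close> and \<open>l\<close> to
      agree, so the index can be capped at \<open>k\<close>.\<close>
    define l' where "l' = min l k"
    have "x = partial \<alpha> l'"
      using l(1) \<open>x \<le> ?s\<close> partial_mono[of k l \<alpha>] k(1) by (auto simp: l'_def min_def)
    then have "x = partial (take k \<alpha>) l'" by (simp add: partial_def l'_def)
    then show "x \<in> partials (take k \<alpha>)" using k(2) by (auto simp: partials_def l'_def)
  qed
  moreover have "take k \<alpha> \<in> comps ?s" "drop k \<alpha> \<in> comps b"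
    using \<alpha>(1) sums by (auto simp: comps_def dest: in_set_takeD in_set_dropD)
  ultimately show "\<alpha> \<in> (\<lambda>(\<alpha>, \<gamma>). \<alpha> @ \<gamma>) ` (refinements \<beta> \<times> comps b)"
    using refinements_eq_partials[OF pos(1)] by (intro image_eqI[of _ _ "(take k \<alpha>, drop k \<alpha>)"]) auto
next
  let ?s = "sum_list \<beta>"
  fix \<delta> assume "\<delta> \<in> (\<lambda>(\<alpha>, \<gamma>). \<alpha> @ \<gamma>) ` (refinements \<beta> \<times> comps b)"
  then obtain \<alpha> \<gamma> where \<delta>: "\<delta> = \<alpha> @ \<gamma>" and \<alpha>: "\<alpha> \<in> comps ?s" "partials \<beta> \<subseteq> partials \<alpha>" and \<gamma>: "\<gamma> \<in> comps b"
    using refinements_eq_partials[OF pos(1)] by auto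
  have "\<delta> \<in> comps (?s + b)" using \<alpha> \<gamma> \<delta> by (auto simp: comps_def)
  moreover have "partials \<alpha> \<subseteq> partials \<delta>"
  proof
    fix x assume "x \<in> partials \<alpha>"
    then obtain k where "x = partial \<delta> k" "k \<le> length \<delta>"
      unfolding partials_def \<delta> by (metis (no_types, lifting) atMost_iff image_iff length_append
          partial_append1 trans_le_add1)
    then show "x \<in> partials \<delta>" by (simp add: partials_def)
  qed
  moreover have "?s + b \<in> partials \<delta>"
    unfolding partials_def by (rule image_eqI[of _ _ "length \<delta>"])
      (use \<open>\<delta> \<in> comps (?s + b)\<close> in \<open>auto simp: partial_def comps_def\<close>)
  ultimately show "\<delta> \<in> refinements (\<beta> @ [b])"
    using refinements_eq_partials[of "\<beta> @ [b]"] pos \<alpha> by (auto simp: partials_snoc)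
qed

section \<open>Multiplicativity of the weight \<open>pi_pair\<close>\<close>

text \<open>Parts of \<gamma> are positive, so each of their blocks ends strictly after
  \<open>sum_list \<beta>\<close>, beyond every block of \<beta>.\<close>

lemma subparts_append:
  assumes \<alpha>: "\<alpha> \<in> comps (sum_list \<beta>)" and \<gamma>: "\<gamma> \<in> comps b" and i: "i < length \<beta>"
  shows "subparts (\<alpha> @ \<gamma>) (\<beta> @ [b]) i = subparts \<alpha> \<beta> i"
proof -
  let ?s = "sum_list \<beta>"
  let ?P = "\<lambda>\<alpha> \<beta> k. partial \<beta> i \<le> partial \<alpha> k \<and> partial \<alpha> (Suc k) \<le> partial \<beta> (Suc i)"
  have "filter (?P (\<alpha> @ \<gamma>) (\<beta> @ [b])) [0..<length \<alpha>] = filter (?P \<alpha> \<beta>) [0..<length \<alpha>]"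
    using i by (intro filter_cong) (auto simp: partial_append1)
  moreover have "\<not> ?P (\<alpha> @ \<gamma>) (\<beta> @ [b]) k" if k: "k \<in> set [length \<alpha>..<length \<alpha> + length \<gamma>]" for k
  proof -
    have "partial (\<alpha> @ \<gamma>) (length \<alpha>) < partial (\<alpha> @ \<gamma>) (Suc k)"
      using k \<alpha> \<gamma> by (intro partial_strict) (auto simp: comps_def)
    moreover have "partial (\<alpha> @ \<gamma>) (length \<alpha>) = ?s"
      using \<alpha> by (simp add: partial_def comps_def)
    moreover have "partial (\<beta> @ [b]) (Suc i) \<le> ?s"
      using i partial_le[of \<beta> "Suc i"] by (simp add: partial_append1)
    ultimately show ?thesis by auto
  qed
  then have "filter (?P (\<alpha> @ \<gamma>) (\<beta> @ [b])) [length \<alpha>..<length \<alpha> + length \<gamma>] = []"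
    by (intro filter_False) blast
  ultimately show ?thesis
    unfolding subparts_def
    by (simp add: upt_add_eq_append[of 0] nth_append cong: map_cong)
qed

text \<open>By positivity the blocks of \<alpha> start strictly before
  \<open>sum_list \<beta>\<close>; those of \<gamma> fill exactly the last block.\<close>

lemma subparts_last:
  assumes \<alpha>: "\<alpha> \<in> comps (sum_list \<beta>)" and \<gamma>: "\<gamma> \<in> comps b"
  shows "subparts (\<alpha> @ \<gamma>) (\<beta> @ [b]) (length \<beta>) = \<gamma>"
proof -
  let ?s = "sum_list \<beta>"
  let ?P = "\<lambda>k. partial (\<beta> @ [b]) (length \<beta>) \<le> partial (\<alpha> @ \<gamma>) k \<and>
                partial (\<alpha> @ \<gamma>) (Suc k) \<le> partial (\<beta> @ [b]) (Suc (length \<beta>))"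
  have s: "partial (\<alpha> @ \<gamma>) (length \<alpha>) = ?s" "partial (\<beta> @ [b]) (length \<beta>) = ?s"
    "partial (\<beta> @ [b]) (Suc (length \<beta>)) = ?s + b"
    using \<alpha> by (auto simp: partial_def comps_def)
  have "\<not> ?P k" if "k \<in> set [0..<length \<alpha>]" for k
  proof -
    have "partial (\<alpha> @ \<gamma>) k < partial (\<alpha> @ \<gamma>) (length \<alpha>)"
      using that \<alpha> \<gamma> by (intro partial_strict) (auto simp: comps_def)
    then show ?thesis using s by auto
  qed
  then have "filter ?P [0..<length \<alpha>] = []"
    by (intro filter_False) blast
  moreover have "?P k" if "k \<in> set [length \<alpha>..<length \<alpha> + length \<gamma>]" for k
    using that s partial_mono[of "length \<alpha>" k "\<alpha> @ \<gamma>"] partial_le[of "\<alpha> @ \<gamma>" "Suc k"] \<alpha> \<gamma>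
    by (auto simp: comps_def)
  then have "filter ?P [length \<alpha>..<length \<alpha> + length \<gamma>] = [length \<alpha>..<length \<alpha> + length \<gamma>]"
    by (intro filter_True) blast
  moreover have "map ((!) (\<alpha> @ \<gamma>)) [length \<alpha>..<length \<alpha> + length \<gamma>] = \<gamma>"
    by (rule nth_equalityI) auto
  ultimately show ?thesis
    unfolding subparts_def by (simp add: upt_add_eq_append[of 0])
qed

lemma pi_pair_append:
  assumes "\<alpha> \<in> comps (sum_list \<beta>)" "\<gamma> \<in> comps b"
  shows "pi_pair (\<alpha> @ \<gamma>) (\<beta> @ [b]) = pi_pair \<alpha> \<beta> * pi_list \<gamma>"
  using subparts_append[OF assms] subparts_last[OF assms]
  by (simp add: pi_pair_def lessThan_Suc mult.commute)

section \<open>Order-preserving colorings with prescribed fibres\<close>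

text \<open>The value 0 outside \<open>A\<close> makes the maps extensional, as in
  \<open>seqs\<close>. The domain and the palette \<open>L\<close> are parameters so that the top
  fibre can be stripped off.\<close>

definition mono_maps :: "('a \<Rightarrow> 'a \<Rightarrow> bool) \<Rightarrow> 'a set \<Rightarrow> nat list \<Rightarrow> (nat \<Rightarrow> nat) \<Rightarrow> ('a \<Rightarrow> nat) set" where
  "mono_maps r A L e = {\<kappa>. (\<forall>i. i \<notin> A \<longrightarrow> \<kappa> i = 0) \<and> (\<forall>i\<in>A. \<kappa> i \<in> set L)
     \<and> (\<forall>i\<in>A. \<forall>j\<in>A. r i j \<longrightarrow> \<kappa> i \<le> \<kappa> j) \<and> (\<forall>c\<in>set L. card {i\<in>A. \<kappa> i = c} = e c)}"

lemma finite_mono_maps: "finite A \<Longrightarrow> finite (mono_maps r A L e)"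
  by (rule finite_subset[OF _ finite_set_of_finite_funs[of A "set L" 0]]) (auto simp: mono_maps_def)

text \<open>The fibre of the largest color is an upset, since colors cannot drop along
  \<open>r\<close>, and the rest is a coloring of the complement by smaller colors. Conversely, any
  upset of the right size may be painted with \<open>c\<close>.\<close>

lemma card_mono_maps_snoc:
  assumes "finite A" and c: "\<forall>d\<in>set L. d < c"
  shows "card (mono_maps r A (L @ [c]) e) =
    (\<Sum>U | U \<in> upsets r A \<and> card U = e c. card (mono_maps r (A - U) L e))"
proof -
  let ?Us = "{U. U \<in> upsets r A \<and> card U = e c}"
  \<comment> \<open>Removed vertices are reset to 0, the default value off
    \<open>A - U\<close>.\<close>
  have "bij_betw (\<lambda>\<kappa>. ({i\<in>A. \<kappa> i = c}, \<lambda>i. if \<kappa> i = c then 0 else \<kappa> i))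
          (mono_maps r A (L @ [c]) e) (SIGMA U:?Us. mono_maps r (A - U) L e)"
  proof (rule bij_betw_byWitness[where f' = "\<lambda>(U, \<kappa>). \<lambda>i. if i \<in> U then c else \<kappa> i"])
    show "\<forall>\<kappa>\<in>mono_maps r A (L @ [c]) e.
        (case ({i \<in> A. \<kappa> i = c}, \<lambda>i. if \<kappa> i = c then 0 else \<kappa> i) of (U, \<kappa>) \<Rightarrow> \<lambda>i. if i \<in> U then c else \<kappa> i) = \<kappa>"
      by (auto simp: mono_maps_def fun_eq_iff)
    have F: "({i \<in> A. (if i \<in> U then c else \<kappa> i) = c},
        \<lambda>i. if (if i \<in> U then c else \<kappa> i) = c then 0 else (if i \<in> U then c else \<kappa> i)) = (U, \<kappa>)"
      if U: "U \<in> upsets r A" and \<kappa>: "\<kappa> \<in> mono_maps r (A - U) L e" for U \<kappa>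
    proof -
      have "U \<subseteq> A" using U by (auto simp: upsets_def)
      moreover have "\<kappa> i \<noteq> c" if "i \<in> A - U" for i
        using \<kappa> that c by (fastforce simp: mono_maps_def)
      moreover have "\<kappa> i = 0" if "i \<notin> A - U" for i
        using \<kappa> that by (auto simp: mono_maps_def)
      ultimately show ?thesis
        by (auto simp: fun_eq_iff split: if_splits)
    qed
    show "\<forall>p\<in>SIGMA U:?Us. mono_maps r (A - U) L e.
      ({i \<in> A. (case p of (U, \<kappa>) \<Rightarrow> \<lambda>i. if i \<in> U then c else \<kappa> i) i = c},
       \<lambda>i. if (case p of (U, \<kappa>) \<Rightarrow> \<lambda>i. if i \<in> U then c else \<kappa> i) i = c then 0
           else (case p of (U, \<kappa>) \<Rightarrow> \<lambda>i. if i \<in> U then c else \<kappa> i) i) = p"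
      by (intro ballI, elim SigmaE, hypsubst, simp only: prod.case mem_Collect_eq F)
    show "(\<lambda>\<kappa>. ({i \<in> A. \<kappa> i = c}, \<lambda>i. if \<kappa> i = c then 0 else \<kappa> i)) ` mono_maps r A (L @ [c]) e
      \<subseteq> (SIGMA U:?Us. mono_maps r (A - U) L e)"
    proof (rule image_subsetI)
      fix \<kappa> assume \<kappa>: "\<kappa> \<in> mono_maps r A (L @ [c]) e"
      have le: "\<kappa> i \<le> c" if "i \<in> A" for i
        using \<kappa> that c by (auto simp: mono_maps_def less_imp_le)
      have "\<forall>x\<in>A. \<forall>y\<in>A. r x y \<longrightarrow> \<kappa> x = c \<longrightarrow> \<kappa> y = c"
      proof (intro ballI impI)
        fix x y assume "x \<in> A" "y \<in> A" "r x y" "\<kappa> x = c"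
        moreover from this have "\<kappa> x \<le> \<kappa> y" using \<kappa> unfolding mono_maps_def by blast
        ultimately show "\<kappa> y = c" using le[of y] by linarith
      qed
      then have "{i \<in> A. \<kappa> i = c} \<in> upsets r A"
        unfolding upsets_def by blast
      moreover have "card {i \<in> A. \<kappa> i = c} = e c"
        using \<kappa> by (simp add: mono_maps_def)
      moreover have "card {i \<in> A - {i\<in>A. \<kappa> i = c}. (if \<kappa> i = c then 0 else \<kappa> i) = d} = e d"
        if d: "d \<in> set L" for d
      proof -
        have "d \<noteq> c" using c d by blast
        then have "{i \<in> A - {i\<in>A. \<kappa> i = c}. (if \<kappa> i = c then 0 else \<kappa> i) = d} = {i\<in>A. \<kappa> i = d}"
          by auto
        then show ?thesis using \<kappa> d by (simp add: mono_maps_def)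
      qed
      then have "(\<lambda>i. if \<kappa> i = c then 0 else \<kappa> i) \<in> mono_maps r (A - {i\<in>A. \<kappa> i = c}) L e"
        unfolding mono_maps_def by (intro CollectI conjI ballI, use \<kappa> in \<open>auto simp: mono_maps_def\<close>)
      ultimately show "({i \<in> A. \<kappa> i = c}, \<lambda>i. if \<kappa> i = c then 0 else \<kappa> i)
          \<in> (SIGMA U:?Us. mono_maps r (A - U) L e)" by auto
    qed
    show "(\<lambda>(U, \<kappa>). \<lambda>i. if i \<in> U then c else \<kappa> i) ` (SIGMA U:?Us. mono_maps r (A - U) L e)
      \<subseteq> mono_maps r A (L @ [c]) e"
    proof (rule image_subsetI)
      fix p assume "p \<in> (SIGMA U:?Us. mono_maps r (A - U) L e)"
      then obtain U \<kappa> where p: "p = (U, \<kappa>)"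
        and U: "U \<in> upsets r A" "card U = e c" and \<kappa>: "\<kappa> \<in> mono_maps r (A - U) L e" by auto
      have UA: "U \<subseteq> A" using U by (auto simp: upsets_def)
      have lt: "\<kappa> i < c" if "i \<in> A - U" for i
        using \<kappa> that c by (auto simp: mono_maps_def)
      let ?k = "\<lambda>i. if i \<in> U then c else \<kappa> i"
      have "\<kappa> i \<noteq> c" if "i \<in> A - U" for i using lt[OF that] by simp
      then have "{i\<in>A. ?k i = c} = U" using UA by auto
      then have "card {i\<in>A. ?k i = c} = e c" using U by simp
      moreover have "card {i\<in>A. ?k i = d} = e d" if d: "d \<in> set L" for d
      proof -
        have "d \<noteq> c" using c d by blast
        then have "{i\<in>A. ?k i = d} = {i\<in>A - U. \<kappa> i = d}" by auto
        then show ?thesis using \<kappa> d by (simp add: mono_maps_def)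
      qed
      moreover have "?k i \<le> ?k j" if "i \<in> A" "j \<in> A" "r i j" for i j
        using that \<kappa> U lt[of i] by (auto simp: mono_maps_def upsets_def)
      moreover have "?k i \<in> set (L @ [c])" if "i \<in> A" for i
        using that \<kappa> by (auto simp: mono_maps_def)
      moreover have "?k i = 0" if "i \<notin> A" for i
        using that \<kappa> UA by (auto simp: mono_maps_def)
      ultimately have "?k \<in> mono_maps r A (L @ [c]) e"
        unfolding mono_maps_def by simp
      then show "(case p of (U, \<kappa>) \<Rightarrow> \<lambda>i. if i \<in> U then c else \<kappa> i) \<in> mono_maps r A (L @ [c]) e"
        by (simp only: p prod.case)
    qed
  qed
  then have "card (mono_maps r A (L @ [c]) e) = card (SIGMA U:?Us. mono_maps r (A - U) L e)"
    by (rule bij_betw_same_card)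
  also have "\<dots> = (\<Sum>U\<in>?Us. card (mono_maps r (A - U) L e))"
    using assms finite_upsets[OF assms(1), of r] by (intro card_SigmaI) (auto simp: finite_mono_maps)
  finally show ?thesis .
qed

text \<open>Strip off the colors from the top. Under \<open>rev\<close>, the parts refining the last
  entry of \<open>map e L\<close> are removed first and exhaust an upset \<open>U\<close>, the
  candidate top fibre. Their weights sum to 1 by \<open>exhaustions_total\<close>, so that only the
  colorings of \<open>A - U\<close> are left to count, as in
  \<open>card_mono_maps_snoc\<close>.\<close>

lemma exhaustions_refinements:
  assumes "finite A" and r: "reflp r" "transp r"
    and "sorted_wrt (<) L" "\<forall>c\<in>set L. 0 < e c"
  shows "(\<Sum>\<alpha>\<in>refinements (map e L). of_nat (exhaustions r (rev \<alpha>) A) / pi_pair \<alpha> (map e L))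
    = of_nat (card (mono_maps r A L e))"
  using assms(1,4,5)
proof (induction L arbitrary: A rule: rev_induct)
  case Nil
  have "refinements [] = {[]}" by (simp add: refinements_def comps_0 Sset_def)
  moreover have "mono_maps r A [] e = (if A = {} then {\<lambda>_. 0} else {})"
    by (auto simp: mono_maps_def)
  ultimately show ?case by (simp add: pi_pair_def)
next
  case (snoc c L)
  let ?\<beta> = "map e L"
  let ?b = "e c"
  let ?Us = "{U. U \<in> upsets r A \<and> card U = ?b}"
  have finA: "finite A" by fact
  have pos: "\<forall>b\<in>set ?\<beta>. 0 < b" "0 < ?b" using snoc.prems by auto
  have c: "\<forall>d\<in>set L. d < c" and sL: "sorted_wrt (<) L"
    using snoc.prems(2) by (auto simp: sorted_wrt_append)
  \<comment> \<open>Both prefixes have the sum of \<open>?\<beta>\<close>, and partial sums of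
    positive parts increase strictly, so the cut is at the same place.\<close>
  have inj: "inj_on (\<lambda>(\<alpha>, \<gamma>). \<alpha> @ \<gamma>) (refinements ?\<beta> \<times> comps ?b)"
  proof (rule inj_onI, clarify)
    fix \<alpha> \<gamma> \<alpha>' \<gamma>'
    assume *: "\<alpha> \<in> refinements ?\<beta>" "\<alpha>' \<in> refinements ?\<beta>" "\<gamma> \<in> comps ?b" "\<gamma>' \<in> comps ?b" "\<alpha> @ \<gamma> = \<alpha>' @ \<gamma>'"
    have "length \<alpha> = length \<alpha>'"
    proof (rule ccontr)
      assume "length \<alpha> \<noteq> length \<alpha>'"
      moreover have "\<forall>a\<in>set (\<alpha> @ \<gamma>). 0 < a" using * by (auto simp: refinements_def comps_def)
      moreover have "length \<alpha>' \<le> length (\<alpha> @ \<gamma>)" using *(5) by simp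
      ultimately have "partial (\<alpha> @ \<gamma>) (length \<alpha>) \<noteq> partial (\<alpha> @ \<gamma>) (length \<alpha>')"
        using partial_strict[of "\<alpha> @ \<gamma>" "length \<alpha>" "length \<alpha>'"]
          partial_strict[of "\<alpha> @ \<gamma>" "length \<alpha>'" "length \<alpha>"] by fastforce
      moreover have "partial (\<alpha> @ \<gamma>) (length \<alpha>) = sum_list \<alpha>" by (simp add: partial_def)
      moreover have "partial (\<alpha> @ \<gamma>) (length \<alpha>') = sum_list \<alpha>'" using *(5) by (simp add: partial_def)
      ultimately show False using * by (simp add: refinements_def comps_def)
    qed
    then show "\<alpha> = \<alpha>' \<and> \<gamma> = \<gamma>'" using *(5) by simp
  qed
  let ?p = "\<lambda>\<alpha> A. of_nat (exhaustions r (rev \<alpha>) A) :: rat"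
  have "(\<Sum>\<alpha>\<in>refinements (map e (L @ [c])). ?p \<alpha> A / pi_pair \<alpha> (map e (L @ [c])))
    = (\<Sum>(\<alpha>, \<gamma>)\<in>refinements ?\<beta> \<times> comps ?b. ?p (\<alpha> @ \<gamma>) A / pi_pair (\<alpha> @ \<gamma>) (?\<beta> @ [?b]))"
    using refinements_snoc[OF pos] by (simp add: sum.reindex[OF inj[unfolded case_prod_unfold]] case_prod_unfold)
  \<comment> \<open>As \<open>rev (\<alpha> @ \<gamma>) = rev \<gamma> @ rev \<alpha>\<close>, the
    exhaustion splits at the upset \<open>U\<close> removed by \<gamma>.\<close>
  also have "\<dots> = (\<Sum>(\<alpha>, \<gamma>)\<in>refinements ?\<beta> \<times> comps ?b. \<Sum>U\<in>?Us.
      (?p \<alpha> (A - U) / pi_pair \<alpha> ?\<beta>) * (?p \<gamma> U / pi_list \<gamma>))"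
  proof (rule sum.cong[OF refl], clarify)
    fix \<alpha> \<gamma> assume *: "\<alpha> \<in> refinements ?\<beta>" "\<gamma> \<in> comps ?b"
    then have "pi_pair (\<alpha> @ \<gamma>) (?\<beta> @ [?b]) = pi_pair \<alpha> ?\<beta> * pi_list \<gamma>"
      by (intro pi_pair_append) (auto simp: refinements_def)
    moreover have "sum_list (rev \<gamma>) = ?b" using * by (simp add: comps_def)
    ultimately show "?p (\<alpha> @ \<gamma>) A / pi_pair (\<alpha> @ \<gamma>) (?\<beta> @ [?b])
      = (\<Sum>U\<in>?Us. (?p \<alpha> (A - U) / pi_pair \<alpha> ?\<beta>) * (?p \<gamma> U / pi_list \<gamma>))"
      using exhaustions_append[OF finA r, of "rev \<gamma>" "rev \<alpha>"]
      by (simp add: sum_divide_distrib mult.commute)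
  qed
  also have "\<dots> = (\<Sum>U\<in>?Us. \<Sum>(\<alpha>, \<gamma>)\<in>refinements ?\<beta> \<times> comps ?b.
      (?p \<alpha> (A - U) / pi_pair \<alpha> ?\<beta>) * (?p \<gamma> U / pi_list \<gamma>))"
    unfolding case_prod_unfold by (rule sum.swap)
  also have "\<dots> = (\<Sum>U\<in>?Us. (\<Sum>\<alpha>\<in>refinements ?\<beta>. ?p \<alpha> (A - U) / pi_pair \<alpha> ?\<beta>)
      * (\<Sum>\<gamma>\<in>comps ?b. ?p \<gamma> U / pi_list \<gamma>))"
    by (simp add: sum_product sum.cartesian_product)
  also have "\<dots> = (\<Sum>U\<in>?Us. of_nat (card (mono_maps r (A - U) L e)))"
  proof (rule sum.cong[OF refl])
    fix U assume U: "U \<in> ?Us"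
    then have "finite U" using finA by (auto simp: upsets_def intro: finite_subset)
    then have "(\<Sum>\<gamma>\<in>comps ?b. ?p \<gamma> U / pi_list \<gamma>) = 1"
      using exhaustions_total[OF _ r(1), of U] U by simp
    moreover have "(\<Sum>\<alpha>\<in>refinements ?\<beta>. ?p \<alpha> (A - U) / pi_pair \<alpha> ?\<beta>)
        = of_nat (card (mono_maps r (A - U) L e))"
      using snoc.prems sL by (intro snoc.IH) auto
    ultimately show "(\<Sum>\<alpha>\<in>refinements ?\<beta>. ?p \<alpha> (A - U) / pi_pair \<alpha> ?\<beta>)
        * (\<Sum>\<gamma>\<in>comps ?b. ?p \<gamma> U / pi_list \<gamma>) = of_nat (card (mono_maps r (A - U) L e))" by simp
  qed
  also have "\<dots> = of_nat (card (mono_maps r A (L @ [c]) e))"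
    by (simp add: card_mono_maps_snoc[OF finA c])
  finally show ?case .
qed

subsection \<open>Linear extensions and descent sets\<close>

definition perms :: "nat \<Rightarrow> nat list set" where
  "perms n = {\<sigma>. distinct \<sigma> \<and> set \<sigma> = {1..n}}"

text \<open>Ties in color are broken by increasing label, so neighbours in the word can share a
  color only where the label increases.\<close>

definition compatible :: "(nat \<Rightarrow> nat) \<Rightarrow> nat list \<Rightarrow> (nat \<Rightarrow> nat) \<Rightarrow> bool" where
  "compatible g \<sigma> \<kappa> \<longleftrightarrow> sorted_wrt (\<lambda>a b. \<kappa> a < \<kappa> b \<or> \<kappa> a = \<kappa> b \<and> g a < g b) \<sigma>"

text \<open>Positions count from 1 as in \<open>qsF\<close>, whereas \<open>!\<close> counts from 0:
  \<open>k\<close> compares the \<open>k\<close>-th letter with the next one.\<close>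

definition Des :: "nat \<Rightarrow> (nat \<Rightarrow> nat) \<Rightarrow> nat list \<Rightarrow> nat set" where
  "Des n g \<sigma> = {k\<in>{1..<n}. g (\<sigma> ! (k - 1)) > g (\<sigma> ! k)}"

definition linexts :: "nat \<Rightarrow> (nat \<times> nat) set \<Rightarrow> nat list set" where
  "linexts n R = {\<sigma>\<in>perms n. sorted_wrt (\<lambda>a b. (b, a) \<notin> R) \<sigma>}"

lemma finite_perms: "finite (perms n)"
  unfolding perms_def
  by (rule finite_subset[OF _ finite_lists_length_eq[of "{1..n}" n]]) (auto dest: distinct_card)

lemma length_perms: "\<sigma> \<in> perms n \<Longrightarrow> length \<sigma> = n"
  by (auto simp: perms_def dest: distinct_card)

text \<open>Although \<open>seqs n\<close> allows infinitely many colors, the exponent vector fixes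
  which of them occur, and one coloring suffices to show that there are finitely many.\<close>

lemma finite_seqs_monomial: "finite {\<kappa>\<in>seqs n. monomial_of n \<kappa> = e}" (is "finite ?K")
proof (cases "?K = {}")
  case False
  then obtain \<kappa>0 where \<kappa>0: "monomial_of n \<kappa>0 = e" by auto
  let ?C = "{c. e c \<noteq> 0}"
  have "?C \<subseteq> \<kappa>0 ` {1..n}"
    unfolding \<kappa>0[symmetric] monomial_of_def by (auto simp: card_eq_0_iff)
  then have fin: "finite ?C" by (rule finite_subset) simp
  have "\<kappa> i \<in> ?C" if "\<kappa> \<in> ?K" "i \<in> {1..n}" for \<kappa> i
  proof -
    have "e (\<kappa> i) = card {j\<in>{1..n}. \<kappa> j = \<kappa> i}"
      using that by (auto simp: monomial_of_def)
    moreover have "i \<in> {j\<in>{1..n}. \<kappa> j = \<kappa> i}" using that by simp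
    ultimately show ?thesis using card_gt_0_iff[of "{j\<in>{1..n}. \<kappa> j = \<kappa> i}"] by auto
  qed
  then have "?K \<subseteq> {f. \<forall>x. (x \<in> {1..n} \<longrightarrow> f x \<in> ?C) \<and> (x \<notin> {1..n} \<longrightarrow> f x = 0)}"
    by (auto simp: seqs_def)
  then show ?thesis
    by (rule finite_subset) (rule finite_set_of_finite_funs[OF finite_atLeastAtMost fin])
qed (simp only: finite.emptyI)

lemma compatible_ex1:
  assumes g: "inj_on g {1..n}"
  shows "\<exists>!\<sigma>. \<sigma> \<in> perms n \<and> compatible g \<sigma> \<kappa>"
proof -
  let ?f = "\<lambda>i. (\<kappa> i, g i)"
  have inj: "inj_on ?f {1..n}" by (rule inj_onI) (auto dest: inj_onD[OF g])
  have comp: "compatible g \<sigma> \<kappa> \<longleftrightarrow> sorted_wrt (<) (map ?f \<sigma>)" for \<sigma>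
  proof -
    have "(\<lambda>a b. \<kappa> a < \<kappa> b \<or> \<kappa> a = \<kappa> b \<and> g a < g b) = (\<lambda>a b. ?f a < ?f b)"
      by (auto simp: fun_eq_iff)
    then show ?thesis by (simp only: compatible_def sorted_wrt_map)
  qed
  let ?\<sigma> = "sort_key ?f [1..<Suc n]"
  have perm: "?\<sigma> \<in> perms n" by (auto simp: perms_def)
  have "distinct (map ?f ?\<sigma>)"
    using perm inj by (simp add: distinct_map perms_def atLeastLessThanSuc_atLeastAtMost)
  then have "sorted_wrt (<) (map ?f ?\<sigma>)"
    by (simp add: strict_sorted_iff)
  then have "?\<sigma> \<in> perms n \<and> compatible g ?\<sigma> \<kappa>" using perm comp by blast
  moreover have "\<sigma> = \<tau>" if "\<sigma> \<in> perms n \<and> compatible g \<sigma> \<kappa>" "\<tau> \<in> perms n \<and> compatible g \<tau> \<kappa>" for \<sigma> \<tau>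
  proof -
    have "map ?f \<sigma> = map ?f \<tau>"
      using that by (intro strict_sorted_equal) (auto simp: comp perms_def)
    then show ?thesis
      using that inj by (intro map_inj_on[of ?f \<sigma> \<tau>]) (auto simp: perms_def)
  qed
  ultimately show ?thesis by blast
qed

text \<open>As \<open>g\<close> decreases along \<open>R\<close>, a tie in color would place
  \<open>j\<close> before \<open>i\<close> for \<open>(i, j) \<in> R\<close>. So \<open>i\<close>
  before \<open>j\<close> amounts to a strict increase.\<close>

lemma linexts_strict_iff:
  assumes R: "R \<subseteq> {1..n} \<times> {1..n}" "\<forall>(i,j)\<in>R. g i > g j"
    and \<sigma>: "\<sigma> \<in> perms n" "compatible g \<sigma> \<kappa>"
  shows "(\<forall>(i,j)\<in>R. \<kappa> i < \<kappa> j) \<longleftrightarrow> \<sigma> \<in> linexts n R"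
proof -
  let ?lt = "\<lambda>a b. \<kappa> a < \<kappa> b \<or> \<kappa> a = \<kappa> b \<and> g a < g b"
  have lt: "?lt (\<sigma> ! k) (\<sigma> ! l)" if "k < l" "l < length \<sigma>" for k l
    using \<sigma>(2) that unfolding compatible_def by (rule sorted_wrt_nth_less)
  show ?thesis
  proof
    assume *: "\<forall>(i,j)\<in>R. \<kappa> i < \<kappa> j"
    have "sorted_wrt (\<lambda>a b. (b, a) \<notin> R) \<sigma>"
      by (rule sorted_wrt_mono_rel[OF _ \<sigma>(2)[unfolded compatible_def]]) (use * in fastforce)
    then show "\<sigma> \<in> linexts n R" using \<sigma>(1) by (simp add: linexts_def)
  next
    assume *: "\<sigma> \<in> linexts n R"
    show "\<forall>(i,j)\<in>R. \<kappa> i < \<kappa> j"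
    proof clarify
      fix i j assume ij: "(i, j) \<in> R"
      then have "i \<in> set \<sigma>" "j \<in> set \<sigma>" using R(1) \<sigma>(1) by (auto simp: perms_def)
      then obtain k l where k: "k < length \<sigma>" "\<sigma> ! k = i" and l: "l < length \<sigma>" "\<sigma> ! l = j"
        unfolding in_set_conv_nth by blast
      have "\<not> l < k"
        using * ij k l sorted_wrt_nth_less[of "\<lambda>a b. (b, a) \<notin> R" \<sigma> l k] by (auto simp: linexts_def)
      moreover have "g i > g j" using R(2) ij by auto
      moreover from this have "k \<noteq> l" using k l by auto
      ultimately show "\<kappa> i < \<kappa> j" using lt[of k l] k l by auto
    qed
  qed
qed

text \<open>The same tie-breaking puts \<open>j\<close> before \<open>i\<close> when their colors
  agree, which is the order that the converse requires, so ties are allowed here.\<close>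

lemma linexts_weak_iff:
  assumes R: "R \<subseteq> {1..n} \<times> {1..n}" "\<forall>(i,j)\<in>R. g i > g j"
    and \<sigma>: "\<sigma> \<in> perms n" "compatible g \<sigma> \<kappa>"
  shows "(\<forall>(i,j)\<in>R. \<kappa> j \<le> \<kappa> i) \<longleftrightarrow> \<sigma> \<in> linexts n (R\<inverse>)"
proof -
  let ?lt = "\<lambda>a b. \<kappa> a < \<kappa> b \<or> \<kappa> a = \<kappa> b \<and> g a < g b"
  have lt: "?lt (\<sigma> ! k) (\<sigma> ! l)" if "k < l" "l < length \<sigma>" for k l
    using \<sigma>(2) that unfolding compatible_def by (rule sorted_wrt_nth_less)
  show ?thesis
  proof
    assume *: "\<forall>(i,j)\<in>R. \<kappa> j \<le> \<kappa> i"
    have "sorted_wrt (\<lambda>a b. (b, a) \<notin> R\<inverse>) \<sigma>"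
      by (rule sorted_wrt_mono_rel[OF _ \<sigma>(2)[unfolded compatible_def]]) (use * R(2) in fastforce)
    then show "\<sigma> \<in> linexts n (R\<inverse>)" using \<sigma>(1) by (simp add: linexts_def)
  next
    assume *: "\<sigma> \<in> linexts n (R\<inverse>)"
    show "\<forall>(i,j)\<in>R. \<kappa> j \<le> \<kappa> i"
    proof clarify
      fix i j assume ij: "(i, j) \<in> R"
      then have "i \<in> set \<sigma>" "j \<in> set \<sigma>" using R(1) \<sigma>(1) by (auto simp: perms_def)
      then obtain k l where k: "k < length \<sigma>" "\<sigma> ! k = i" and l: "l < length \<sigma>" "\<sigma> ! l = j"
        unfolding in_set_conv_nth by blast
      have "\<not> k < l"
        using * ij k l sorted_wrt_nth_less[of "\<lambda>a b. (b, a) \<notin> R\<inverse>" \<sigma> k l] by (auto simp: linexts_def)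
      then show "\<kappa> j \<le> \<kappa> i" using lt[of l k] k l by (cases "l = k") auto
    qed
  qed
qed

section \<open>Colorings and fundamental quasisymmetric functions\<close>

text \<open>The colors read along \<sigma> increase weakly, and ties between neighbours are excluded
  exactly at descents of the labels, which is the condition in \<open>qsF\<close>. Permuting
  positions keeps the monomial.\<close>

lemma card_compatible:
  assumes \<sigma>: "\<sigma> \<in> perms n" and g: "inj_on g {1..n}"
  shows "of_nat (card {\<kappa>\<in>seqs n. compatible g \<sigma> \<kappa> \<and> monomial_of n \<kappa> = e}) = qsF n (Des n g \<sigma>) e"
proof -
  have len: "length \<sigma> = n" and dist: "distinct \<sigma>" and set: "set \<sigma> = {1..n}"
    using \<sigma> length_perms by (auto simp: perms_def)
  define p where "p i = \<sigma> ! (i - 1)" for i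
  have p: "bij_betw p {1..n} {1..n}"
  proof -
    have "bij_betw (\<lambda>i. i - 1) {1..n} {..<n}"
      by (rule bij_betw_byWitness[where f' = Suc]) auto
    moreover have "bij_betw ((!) \<sigma>) {..<n} {1..n}"
      using bij_betw_nth[OF dist] len set by simp
    ultimately show ?thesis
      using bij_betw_trans[of "\<lambda>i. i - 1" _ _ "(!) \<sigma>"] by (simp add: p_def[abs_def] comp_def)
  qed
  \<comment> \<open>\<open>h\<close> reads a coloring along the word, with 0 outside
    \<open>{1..n}\<close>; \<open>q\<close> inverts \<open>p\<close> and later gives the inverse map
    \<open>h'\<close>.\<close>
  define h where "h \<kappa> = (\<lambda>i. if i \<in> {1..n} then \<kappa> (p i) else 0)" for \<kappa> :: "nat \<Rightarrow> nat"
  define q where "q = inv_into {1..n} p"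
  have q: "q i \<in> {1..n}" "p (q i) = i" if "i \<in> {1..n}" for i
    using p that unfolding q_def by (metis bij_betw_def inv_into_into, metis bij_betw_def f_inv_into_f)
  have qp: "q (p i) = i" "p i \<in> {1..n}" if "i \<in> {1..n}" for i
    using p that unfolding q_def by (auto simp: bij_betw_def)
  have mon: "monomial_of n (h \<kappa>) = monomial_of n \<kappa>" for \<kappa>
  proof
    fix c
    have "bij_betw p {i\<in>{1..n}. h \<kappa> i = c} {i\<in>{1..n}. \<kappa> i = c}"
      by (rule bij_betw_byWitness[where f' = q]) (auto simp: h_def q qp simp del: atLeastAtMost_iff One_nat_def)
    then show "monomial_of n (h \<kappa>) c = monomial_of n \<kappa> c"
      unfolding monomial_of_def by (rule bij_betw_same_card)
  qed
  let ?lt = "\<lambda>\<kappa> a b. \<kappa> a < \<kappa> b \<or> \<kappa> a = \<kappa> b \<and> g a < (g b :: nat)"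
  have comp: "compatible g \<sigma> \<kappa> \<longleftrightarrow>
    (\<forall>i\<in>{1..<n}. h \<kappa> i \<le> h \<kappa> (Suc i) \<and> (i \<in> Des n g \<sigma> \<longrightarrow> h \<kappa> i < h \<kappa> (Suc i)))" for \<kappa> :: "nat \<Rightarrow> nat"
  proof -
    have "transp (?lt \<kappa>)" by (auto simp: transp_def)
    then have "compatible g \<sigma> \<kappa> \<longleftrightarrow> (\<forall>i. Suc i < n \<longrightarrow> ?lt \<kappa> (\<sigma> ! i) (\<sigma> ! Suc i))"
      unfolding compatible_def len[symmetric] by (rule sorted_wrt_iff_nth_Suc_transp)
    also have "\<dots> \<longleftrightarrow> (\<forall>i\<in>{1..<n}. ?lt \<kappa> (p i) (p (Suc i)))"
    proof
      assume "\<forall>i. Suc i < n \<longrightarrow> ?lt \<kappa> (\<sigma> ! i) (\<sigma> ! Suc i)"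
      then have "?lt \<kappa> (p (Suc i)) (p (Suc (Suc i)))" if "Suc i < n" for i using that by (simp add: p_def)
      then show "\<forall>i\<in>{1..<n}. ?lt \<kappa> (p i) (p (Suc i))"
        by (metis (no_types, lifting) One_nat_def Suc_le_D atLeastLessThan_iff)
    next
      assume *: "\<forall>i\<in>{1..<n}. ?lt \<kappa> (p i) (p (Suc i))"
      then have "?lt \<kappa> (p (Suc i)) (p (Suc (Suc i)))" if "Suc i < n" for i using that by auto
      then show "\<forall>i. Suc i < n \<longrightarrow> ?lt \<kappa> (\<sigma> ! i) (\<sigma> ! Suc i)" by (simp add: p_def)
    qed
    also have "\<dots> \<longleftrightarrow> (\<forall>i\<in>{1..<n}. h \<kappa> i \<le> h \<kappa> (Suc i) \<and> (i \<in> Des n g \<sigma> \<longrightarrow> h \<kappa> i < h \<kappa> (Suc i)))"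
    proof (rule ball_cong[OF refl])
      fix i assume i: "i \<in> {1..<n}"
      \<comment> \<open>Labels of neighbours differ, so a non-descent is a strict ascent of
        \<open>g\<close> and permits a tie.\<close>
      then have "p i \<noteq> p (Suc i)" using qp(1)[of i] qp(1)[of "Suc i"] by auto
      then have "g (p i) \<noteq> g (p (Suc i))" 
        using inj_on_eq_iff[OF g, of "p i" "p (Suc i)"] qp(2)[of i] qp(2)[of "Suc i"] i by simp
      moreover have "i \<in> Des n g \<sigma> \<longleftrightarrow> g (p i) > g (p (Suc i))" using i by (simp add: Des_def p_def)
      moreover have "h \<kappa> i = \<kappa> (p i)" "h \<kappa> (Suc i) = \<kappa> (p (Suc i))" using i by (auto simp: h_def)
      ultimately show "?lt \<kappa> (p i) (p (Suc i)) \<longleftrightarrow>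
         h \<kappa> i \<le> h \<kappa> (Suc i) \<and> (i \<in> Des n g \<sigma> \<longrightarrow> h \<kappa> i < h \<kappa> (Suc i))" by auto
    qed
    finally show ?thesis .
  qed
  let ?J = "{j\<in>seqs n. (\<forall>i\<in>{1..<n}. j i \<le> j (Suc i) \<and> (i \<in> Des n g \<sigma> \<longrightarrow> j i < j (Suc i)))
                                   \<and> monomial_of n j = e}"
  have hs: "h \<kappa> \<in> seqs n" if "\<kappa> \<in> seqs n" for \<kappa>
    using that qp(2) by (auto simp: seqs_def h_def simp del: atLeastAtMost_iff One_nat_def)
  define h' where "h' j = (\<lambda>i. if i \<in> {1..n} then j (q i) else 0)" for j :: "nat \<Rightarrow> nat"
  have h's: "h' \<kappa> \<in> seqs n" if "\<kappa> \<in> seqs n" for \<kappa>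
    using that q(1) by (auto simp: seqs_def h'_def simp del: atLeastAtMost_iff One_nat_def)
  have h'h: "h' (h \<kappa>) = \<kappa>" "h (h' \<kappa>) = \<kappa>" if "\<kappa> \<in> seqs n" for \<kappa>
    using that q qp by (auto simp: seqs_def h_def h'_def fun_eq_iff simp del: atLeastAtMost_iff One_nat_def)
  have "bij_betw h {\<kappa>\<in>seqs n. compatible g \<sigma> \<kappa> \<and> monomial_of n \<kappa> = e} ?J"
  proof (rule bij_betw_byWitness[where f' = h'])
    show "h ` {\<kappa>\<in>seqs n. compatible g \<sigma> \<kappa> \<and> monomial_of n \<kappa> = e} \<subseteq> ?J"
      using comp mon hs by blast
    show "h' ` ?J \<subseteq> {\<kappa>\<in>seqs n. compatible g \<sigma> \<kappa> \<and> monomial_of n \<kappa> = e}"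
    proof clarify
      fix j assume j: "j \<in> seqs n" "\<forall>i\<in>{1..<n}. j i \<le> j (Suc i) \<and> (i \<in> Des n g \<sigma> \<longrightarrow> j i < j (Suc i))"
      show "h' j \<in> seqs n \<and> compatible g \<sigma> (h' j) \<and> monomial_of n (h' j) = monomial_of n j"
        using comp[of "h' j"] mon[of "h' j"] h'h(2)[OF j(1)] h's[OF j(1)] j(2) by simp
    qed
  qed (use h'h in auto)
  then have "card {\<kappa>\<in>seqs n. compatible g \<sigma> \<kappa> \<and> monomial_of n \<kappa> = e} = card ?J"
    by (rule bij_betw_same_card)
  then show ?thesis by (simp only: qsF_def)
qed

text \<open>Each coloring is compatible with exactly one permutation, and that permutation decides
  \<open>P\<close>, so the colorings split into the classes of \<open>card_compatible\<close>.
  \<open>P\<close> is general to serve the strict and the weak case.\<close>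

lemma card_linexts:
  assumes g: "inj_on g {1..n}"
    and P: "\<And>\<kappa> \<sigma>. \<sigma> \<in> perms n \<Longrightarrow> compatible g \<sigma> \<kappa> \<Longrightarrow> P \<kappa> \<longleftrightarrow> \<sigma> \<in> LE"
    and LE: "LE \<subseteq> perms n"
  shows "of_nat (card {\<kappa>\<in>seqs n. P \<kappa> \<and> monomial_of n \<kappa> = e}) = (\<Sum>\<sigma>\<in>LE. qsF n (Des n g \<sigma>) e)"
proof -
  let ?C = "\<lambda>\<sigma>. {\<kappa>\<in>seqs n. compatible g \<sigma> \<kappa> \<and> monomial_of n \<kappa> = e}"
  have "{\<kappa>\<in>seqs n. P \<kappa> \<and> monomial_of n \<kappa> = e} = (\<Union>\<sigma>\<in>LE. ?C \<sigma>)"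
  proof (intro equalityI subsetI)
    fix \<kappa> assume \<kappa>: "\<kappa> \<in> {\<kappa>\<in>seqs n. P \<kappa> \<and> monomial_of n \<kappa> = e}"
    obtain \<sigma> where "\<sigma> \<in> perms n" "compatible g \<sigma> \<kappa>" using compatible_ex1[OF g, of \<kappa>] by blast
    then show "\<kappa> \<in> (\<Union>\<sigma>\<in>LE. ?C \<sigma>)" using \<kappa> P by blast
  qed (use P LE in blast)
  moreover have "card (\<Union>\<sigma>\<in>LE. ?C \<sigma>) = (\<Sum>\<sigma>\<in>LE. card (?C \<sigma>))"
  proof (rule card_UN_disjoint)
    show "finite LE" using LE finite_perms by (rule finite_subset)
    show "\<forall>\<sigma>\<in>LE. finite (?C \<sigma>)"
      by (intro ballI finite_subset[OF _ finite_seqs_monomial[of n e]]) auto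
    show "\<forall>\<sigma>\<in>LE. \<forall>\<tau>\<in>LE. \<sigma> \<noteq> \<tau> \<longrightarrow> ?C \<sigma> \<inter> ?C \<tau> = {}"
      using compatible_ex1[OF g] LE by blast
  qed
  moreover have "of_nat (\<Sum>\<sigma>\<in>LE. card (?C \<sigma>)) = (\<Sum>\<sigma>\<in>LE. qsF n (Des n g \<sigma>) e)"
    using LE card_compatible[OF _ g] by (auto simp only: of_nat_sum intro!: sum.cong)
  ultimately show ?thesis by simp
qed

section \<open>Reversal of words and the action of \<omega>\<close>

text \<open>Position \<open>k\<close> of the reversed word compares the letters at position
  \<open>n - k\<close> of \<sigma> in the opposite order; injectivity of \<open>g\<close> turns
  non-descents into descents.\<close>

lemma omega_set_Des:
  assumes \<sigma>: "\<sigma> \<in> perms n" and g: "inj_on g {1..n}"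
  shows "omega_set n (Des n g \<sigma>) = Des n g (rev \<sigma>)"
proof (rule set_eqI)
  fix k
  have len: "length \<sigma> = n" using \<sigma> by (rule length_perms)
  show "k \<in> omega_set n (Des n g \<sigma>) \<longleftrightarrow> k \<in> Des n g (rev \<sigma>)"
  proof (cases "k \<in> {1..<n}")
    case k: True
    have 1: "rev \<sigma> ! (k - 1) = \<sigma> ! (n - k)" "rev \<sigma> ! k = \<sigma> ! (n - k - 1)"
      using k len by (auto simp: rev_nth Suc_diff_le)
    have "g (\<sigma> ! (n - k)) \<noteq> g (\<sigma> ! (n - k - 1))"
    proof -
      have "\<sigma> ! (n - k) \<noteq> \<sigma> ! (n - k - 1)"
        using \<sigma> k len by (auto simp: perms_def nth_eq_iff_index_eq)
      moreover have "\<sigma> ! (n - k) \<in> {1..n}" "\<sigma> ! (n - k - 1) \<in> {1..n}"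
        using \<sigma> k len nth_mem[of "n - k" \<sigma>] nth_mem[of "n - k - 1" \<sigma>] by (auto simp: perms_def)
      ultimately show ?thesis using g by (meson inj_onD)
    qed
    moreover have "k \<in> (\<lambda>s. n - s) ` Des n g \<sigma> \<longleftrightarrow> n - k \<in> Des n g \<sigma>"
      using k by (force simp: Des_def intro: rev_image_eqI)
    ultimately show ?thesis using k 1 by (auto simp: omega_set_def Des_def)
  qed (auto simp: omega_set_def Des_def)
qed

lemma linexts_rev: "rev ` linexts n R = linexts n (R\<inverse>)"
proof -
  have sub: "rev ` linexts n R \<subseteq> linexts n (R\<inverse>)" for R
    by (rule image_subsetI) (simp add: linexts_def perms_def sorted_wrt_rev)
  have "rev ` linexts n (R\<inverse>) \<subseteq> linexts n R" using sub[of "R\<inverse>"] by simp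
  then have "rev ` rev ` linexts n (R\<inverse>) \<subseteq> rev ` linexts n R" by (rule image_mono)
  then show ?thesis using sub[of R] by (simp add: image_image)
qed

text \<open>When \<open>g\<close> decreases along \<open>R\<close>, the left side is \<omega> of the
  strict generating function of \<open>R\<close> and the right side is the weak one of its converse;
  reversal of words matches the terms.\<close>

lemma sum_linexts_omega:
  assumes g: "inj_on g {1..n}"
  shows "(\<Sum>\<sigma>\<in>linexts n R. qsF n (omega_set n (Des n g \<sigma>)) e)
       = (\<Sum>\<sigma>\<in>linexts n (R\<inverse>). qsF n (Des n g \<sigma>) e)"
  unfolding linexts_rev[symmetric]
  by (subst sum.reindex) (auto simp: inj_on_def omega_set_Des[OF _ g] linexts_def)

subsection \<open>Power sum expansion\<close>

text \<open>The colors that occur, in increasing order. For infinite support this is the empty list,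
  hence the finiteness conditions below.\<close>

definition exps :: "(nat \<Rightarrow> nat) \<Rightarrow> nat list" where
  "exps e = sorted_list_of_set {c. e c \<noteq> 0}"

text \<open>Strictly increasing indices are distinct, so the exponent at \<open>i k\<close> is the
  single part \<open>\<beta> ! k\<close>, and positive parts make the support the range of
  \<open>i\<close>. Its increasing enumeration recovers both \<open>i\<close> and \<beta>.\<close>

lemma qsM_index_unique:
  fixes i :: "nat \<Rightarrow> nat"
  assumes pos: "\<forall>b\<in>set \<beta>. 0 < b"
    and i: "\<forall>k<length \<beta>. 0 < i k" "\<forall>k. Suc k < length \<beta> \<longrightarrow> i k < i (Suc k)"
    and e: "e = (\<lambda>c. \<Sum>k<length \<beta>. if i k = c then \<beta> ! k else 0)"
  shows "finite {c. e c \<noteq> 0}" "e 0 = 0" "map i [0..<length \<beta>] = exps e" "\<beta> = map e (exps e)"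
proof -
  let ?l = "length \<beta>"
  have sorted: "sorted_wrt (<) (map i [0..<?l])"
    by (subst sorted_wrt_iff_nth_Suc_transp) (use i in auto)
  then have "distinct (map i [0..<?l])" using strict_sorted_iff by blast
  then have inj: "inj_on i {..<?l}" by (simp add: distinct_map atLeast0LessThan)
  have ei: "e (i k) = \<beta> ! k" if "k < ?l" for k
  proof -
    have "e (i k) = (\<Sum>m<?l. if m = k then \<beta> ! m else 0)"
      unfolding e using inj that by (intro sum.cong) (auto simp: inj_on_eq_iff)
    then show ?thesis using that by simp
  qed
  have supp: "{c. e c \<noteq> 0} = i ` {..<?l}"
  proof (intro equalityI subsetI)
    fix c assume "c \<in> {c. e c \<noteq> 0}"
    then have "(\<Sum>k<?l. if i k = c then \<beta> ! k else 0) \<noteq> 0" by (simp add: e)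
    then obtain k where "k \<in> {..<?l}" "(if i k = c then \<beta> ! k else 0) \<noteq> 0"
      by (rule sum.not_neutral_contains_not_neutral)
    then show "c \<in> i ` {..<?l}" by (auto split: if_splits)
  qed (use ei pos in auto)
  show "finite {c. e c \<noteq> 0}" unfolding supp by simp
  have "0 \<notin> {c. e c \<noteq> 0}" unfolding supp using i(1) by auto
  then show "e 0 = 0" by simp
  show L: "map i [0..<?l] = exps e"
    using sorted supp by (intro strict_sorted_equal) (auto simp: exps_def atLeast0LessThan)
  show "\<beta> = map e (exps e)"
    unfolding L[symmetric] by (rule nth_equalityI) (auto simp: ei)
qed

text \<open>Conversely, the enumerated support is an index sequence for
  \<open>map e (exps e)\<close>; its entries are positive because \<open>e 0 = 0\<close>.\<close>

lemma qsM_index_exists: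
  assumes fin: "finite {c. e c \<noteq> 0}" and e0: "e 0 = (0::nat)"
    and L: "L = exps e" and i: "i = (\<lambda>k. if k < length L then L ! k else 0)"
  shows "\<forall>k<length L. 0 < i k" "\<forall>k. Suc k < length L \<longrightarrow> i k < i (Suc k)"
    "e = (\<lambda>c. \<Sum>k<length L. if i k = c then map e L ! k else 0)"
proof -
  have set: "set L = {c. e c \<noteq> 0}" and sorted: "sorted_wrt (<) L" and dist: "distinct L"
    using fin by (auto simp: L exps_def)
  show "\<forall>k<length L. 0 < i k"
    using set e0 nth_mem by (fastforce simp: i intro: Nat.gr0I)
  show "\<forall>k. Suc k < length L \<longrightarrow> i k < i (Suc k)"
    using sorted by (auto simp: i sorted_wrt_nth_less)
  show "e = (\<lambda>c. \<Sum>k<length L. if i k = c then map e L ! k else 0)"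
  proof
    fix c
    have "(\<Sum>k<length L. if i k = c then map e L ! k else 0) = (\<Sum>k<length L. if L ! k = c then e c else 0)"
      by (intro sum.cong) (auto simp: i)
    also have "\<dots> = (\<Sum>d\<in>set L. if d = c then e c else 0)"
      using sum.reindex_bij_betw[OF bij_betw_nth[OF dist refl refl], of "\<lambda>d. if d = c then e c else 0"] .
    also have "\<dots> = e c" by (subst sum.delta) (use set fin in auto)
    finally show "e c = (\<Sum>k<length L. if i k = c then map e L ! k else 0)" by simp
  qed
qed

lemma qsM_eq:
  assumes "\<beta> \<in> comps n"
  shows "qsM \<beta> e = (if finite {c. e c \<noteq> 0} \<and> e 0 = 0 \<and> \<beta> = map e (exps e) then 1 else 0)"
proof -
  define I where "I = {i. (\<forall>k. length \<beta> \<le> k \<longrightarrow> i k = 0) \<and> (\<forall>k<length \<beta>. 0 < i k)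
       \<and> (\<forall>k. Suc k < length \<beta> \<longrightarrow> i k < i (Suc k))
       \<and> e = (\<lambda>c. \<Sum>k<length \<beta>. if i k = c then \<beta> ! k else 0)}"
  let ?A = "finite {c. e c \<noteq> 0} \<and> e 0 = 0 \<and> \<beta> = map e (exps e)"
  let ?i = "\<lambda>k. if k < length (exps e) then exps e ! k else 0"
  have pos: "\<forall>b\<in>set \<beta>. 0 < b" using assms by (simp add: comps_def)
  have A: "?A \<and> i = ?i" if "i \<in> I" for i
  proof -
    have i: "\<forall>k<length \<beta>. 0 < i k" "\<forall>k. Suc k < length \<beta> \<longrightarrow> i k < i (Suc k)"
      "e = (\<lambda>c. \<Sum>k<length \<beta>. if i k = c then \<beta> ! k else 0)" "\<forall>k. length \<beta> \<le> k \<longrightarrow> i k = 0"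
      using that unfolding I_def by blast+
    note u = qsM_index_unique[OF pos i(1-3)]
    have len: "length (exps e) = length \<beta>" by (simp flip: u(3))
    have "i k = exps e ! k" if "k < length \<beta>" for k
      using that by (simp flip: u(3))
    then have "i = ?i" using i(4) len by (auto simp: fun_eq_iff)
    then show ?thesis using u by simp
  qed
  have "?i \<in> I" if ?A
  proof -
    have len: "length \<beta> = length (exps e)" using that by (metis length_map)
    have "finite {c. e c \<noteq> 0}" "e 0 = 0" using that by auto
    note x = qsM_index_exists[OF this refl refl]
    show ?thesis unfolding I_def len using x that by auto
  qed
  moreover have "I \<subseteq> {?i}" using A by blast
  ultimately have "I = {?i}" if ?A using that by blast
  moreover have "I = {}" if "\<not> ?A" using A that by blast
  ultimately have "card I = (if ?A then card {?i} else card ({} :: (nat \<Rightarrow> nat) set))"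
    by (simp only: if_True if_False split: if_split) blast
  then show ?thesis unfolding qsM_def I_def[symmetric] by simp
qed

lemma zee_nonzero: "\<alpha> \<in> comps n \<Longrightarrow> zee \<alpha> \<noteq> 0"
  by (auto simp: zee_def comps_def)

lemma sum_const_poly: "(\<Sum>x\<in>A. [:f x:]) = [:\<Sum>x\<in>A. f x:]"
  by (induction A rule: infinite_finite_induct) auto

lemma monomial_of_support:
  assumes \<kappa>: "\<kappa> \<in> seqs n" and e: "monomial_of n \<kappa> = e"
  shows "finite {c. e c \<noteq> 0}" "e 0 = 0" "map e (exps e) \<in> comps n"
    "\<And>i. i \<in> {1..n} \<Longrightarrow> e (\<kappa> i) \<noteq> 0"
proof -
  have ec: "e c = card {i\<in>{1..n}. \<kappa> i = c}" for c
    by (simp add: e[symmetric] monomial_of_def)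
  have "{c. e c \<noteq> 0} \<subseteq> \<kappa> ` {1..n}"
    by (auto simp: ec card_eq_0_iff)
  then show fin: "finite {c. e c \<noteq> 0}" by (rule finite_subset) simp
  have "{i\<in>{1..n}. \<kappa> i = 0} = {}" using \<kappa> by (auto simp: seqs_def)
  then show "e 0 = 0" by (simp only: ec card.empty)
  show nz: "e (\<kappa> i) \<noteq> 0" if "i \<in> {1..n}" for i
    unfolding ec using that by (subst card_0_eq) auto
  have "sum_list (map e (exps e)) = (\<Sum>c\<in>{c. e c \<noteq> 0}. e c)"
    using fin by (subst sum_list_distinct_conv_sum_set) (auto simp: exps_def)
  also have "\<dots> = (\<Sum>c\<in>{c. e c \<noteq> 0}. \<Sum>i\<in>{i\<in>{1..n}. \<kappa> i = c}. 1)"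
    by (simp only: ec card_eq_sum)
  \<comment> \<open>Double counting: every vertex lies in the fibre of exactly one color of the
    support.\<close>
  also have "\<dots> = (\<Sum>i\<in>{1..n}. 1)"
    using fin nz by (intro sum.group) auto
  finally show "map e (exps e) \<in> comps n"
    using fin by (auto simp: comps_def exps_def)
qed

text \<open>\<open>mono_maps\<close> prescribes fibre sizes only on the support. The other fibres
  are empty since all colors lie in the support, so the monomial is determined.\<close>

lemma weak_eq_mono_maps:
  assumes "finite {c. e c \<noteq> 0}" "e 0 = 0"
  shows "{\<kappa>\<in>seqs n. (\<forall>i\<in>{1..n}. \<forall>j\<in>{1..n}. r i j \<longrightarrow> \<kappa> i \<le> \<kappa> j) \<and> monomial_of n \<kappa> = e}
    = mono_maps r {1..n} (exps e) e"
proof -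
  have set: "set (exps e) = {c. e c \<noteq> 0}" using assms by (simp add: exps_def)
  have "\<kappa> \<in> seqs n \<and> monomial_of n \<kappa> = e \<longleftrightarrow> (\<forall>i. i \<notin> {1..n} \<longrightarrow> \<kappa> i = 0) \<and>
    (\<forall>i\<in>{1..n}. e (\<kappa> i) \<noteq> 0) \<and> (\<forall>c. e c \<noteq> 0 \<longrightarrow> card {i\<in>{1..n}. \<kappa> i = c} = e c)" (is "?l \<longleftrightarrow> ?r") for \<kappa>
  proof
    assume ?l
    then show ?r using monomial_of_support(4)[of \<kappa> n e] by (auto simp: seqs_def monomial_of_def)
  next
    assume r: ?r
    have "card {i\<in>{1..n}. \<kappa> i = c} = e c" for c
    proof (cases "e c = 0")
      case True
      then have "{i\<in>{1..n}. \<kappa> i = c} = {}" using r by blast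
      then show ?thesis using True by (simp only: card.empty)
    qed (use r in blast)
    moreover have "\<kappa> i \<noteq> 0" if "i \<in> {1..n}" for i
      using r that assms(2) by metis
    ultimately show ?l using r by (simp add: seqs_def monomial_of_def)
  qed
  then show ?thesis unfolding mono_maps_def set by blast
qed

text \<open>Insert \<open>Psi\<close>, cancel \<open>zee\<close> and exchange the sums over \<alpha>
  and \<beta>. At a fixed \<open>e\<close> at most one \<beta> survives, and its coefficient is the
  sum in \<open>exhaustions_refinements\<close>.\<close>

lemma weak_expansion:
  assumes r: "reflp r" "transp r"
  shows "of_nat (card {\<kappa>\<in>seqs n. (\<forall>i\<in>{1..n}. \<forall>j\<in>{1..n}. r i j \<longrightarrow> \<kappa> i \<le> \<kappa> j) \<and> monomial_of n \<kappa> = e})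
    = (\<Sum>\<alpha>\<in>comps n. of_nat (exhaustions r (rev \<alpha>) {1..n}) * [:1 / zee \<alpha>:] * Psi n \<alpha> e)"
proof -
  let ?N = "\<lambda>\<alpha>. of_nat (exhaustions r (rev \<alpha>) {1..n}) :: rat"
  let ?W = "{\<kappa>\<in>seqs n. (\<forall>i\<in>{1..n}. \<forall>j\<in>{1..n}. r i j \<longrightarrow> \<kappa> i \<le> \<kappa> j) \<and> monomial_of n \<kappa> = e}"
  let ?s = "\<lambda>\<beta>. \<Sum>\<alpha>\<in>refinements \<beta>. ?N \<alpha> / pi_pair \<alpha> \<beta>"
  let ?\<beta> = "map e (exps e)"
  let ?A = "finite {c. e c \<noteq> 0} \<and> e 0 = 0"
  have "(\<Sum>\<alpha>\<in>comps n. of_nat (exhaustions r (rev \<alpha>) {1..n}) * [:1 / zee \<alpha>:] * Psi n \<alpha> e)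
    = (\<Sum>\<alpha>\<in>comps n. \<Sum>\<beta>\<in>{\<beta>\<in>comps n. Sset \<beta> \<subseteq> Sset \<alpha>}. [:?N \<alpha> / pi_pair \<alpha> \<beta>:] * qsM \<beta> e)"
  proof (rule sum.cong[OF refl])
    fix \<alpha> assume "\<alpha> \<in> comps n"
    then have "of_nat (exhaustions r (rev \<alpha>) {1..n}) * [:1 / zee \<alpha>:] * [:zee \<alpha>:] = [:?N \<alpha>:]"
      using zee_nonzero[of \<alpha> n] by (simp add: of_nat_poly)
    then show "of_nat (exhaustions r (rev \<alpha>) {1..n}) * [:1 / zee \<alpha>:] * Psi n \<alpha> e
      = (\<Sum>\<beta>\<in>{\<beta>\<in>comps n. Sset \<beta> \<subseteq> Sset \<alpha>}. [:?N \<alpha> / pi_pair \<alpha> \<beta>:] * qsM \<beta> e)"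
      unfolding Psi_def mult.assoc[symmetric] sum_distrib_left by simp
  qed
  also have "\<dots> = (\<Sum>\<beta>\<in>comps n. \<Sum>\<alpha>\<in>{\<alpha>\<in>comps n. Sset \<beta> \<subseteq> Sset \<alpha>}. [:?N \<alpha> / pi_pair \<alpha> \<beta>:] * qsM \<beta> e)"
    by (rule sum.swap_restrict) (simp_all add: finite_comps)
  also have "\<dots> = (\<Sum>\<beta>\<in>comps n. [:?s \<beta>:] * qsM \<beta> e)"
  proof (rule sum.cong[OF refl])
    fix \<beta> assume "\<beta> \<in> comps n"
    then have "refinements \<beta> = {\<alpha>\<in>comps n. Sset \<beta> \<subseteq> Sset \<alpha>}" by (simp add: refinements_def comps_def)
    then show "(\<Sum>\<alpha>\<in>{\<alpha>\<in>comps n. Sset \<beta> \<subseteq> Sset \<alpha>}. [:?N \<alpha> / pi_pair \<alpha> \<beta>:] * qsM \<beta> e)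
      = [:?s \<beta>:] * qsM \<beta> e"
      by (simp only: sum_const_poly[symmetric] sum_distrib_right)
  qed
  \<comment> \<open>\<open>qsM \<beta> e\<close> vanishes unless \<beta> lists the nonzero exponents
    of \<open>e\<close> in order.\<close>
  also have "\<dots> = (\<Sum>\<beta>\<in>comps n. if \<beta> = ?\<beta> then (if ?A then [:?s ?\<beta>:] else 0) else 0)"
    by (intro sum.cong) (auto simp: qsM_eq)
  also have "\<dots> = (if ?A \<and> ?\<beta> \<in> comps n then [:?s ?\<beta>:] else 0)"
    by (simp add: finite_comps)
  also have "\<dots> = of_nat (card ?W)"
  proof (cases "?A \<and> ?\<beta> \<in> comps n")
    case True
    then have "sorted_wrt (<) (exps e)" "\<forall>c\<in>set (exps e). 0 < e c" by (auto simp: exps_def)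
    then have "?s ?\<beta> = of_nat (card (mono_maps r {1..n} (exps e) e))"
      by (intro exhaustions_refinements[OF _ r]) auto
    moreover have "?W = mono_maps r {1..n} (exps e) e"
      using True by (intro weak_eq_mono_maps) auto
    ultimately show ?thesis using True by (simp only: of_nat_poly simp_thms if_True)
  next
    case False
    then have "?W = {}" using monomial_of_support[of _ n e] by blast
    then show ?thesis using False by (simp only: card.empty of_nat_0 if_False)
  qed
  finally show ?thesis by simp
qed

section \<open>Acyclic orientations induced by proper colorings\<close>

text \<open>Edges point to the larger color, whatever their direction in \<open>E\<close>.
  Multiplicities are dropped here and return in \<open>orient_asc\<close>.\<close>

definition orient :: "(nat \<times> nat) multiset \<Rightarrow> (nat \<Rightarrow> nat) \<Rightarrow> (nat \<times> nat) set" where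
  "orient E \<kappa> = {(i, j). ((i, j) \<in># E \<or> (j, i) \<in># E) \<and> \<kappa> i < \<kappa> j}"

definition orient_asc :: "(nat \<times> nat) multiset \<Rightarrow> (nat \<times> nat) set \<Rightarrow> nat" where
  "orient_asc E R = size (filter_mset (\<lambda>p. p \<in> R) E)"

lemma asc_orient: "asc E \<kappa> = orient_asc E (orient E \<kappa>)"
  unfolding asc_def orient_asc_def
  by (intro arg_cong[of _ _ size] filter_mset_cong) (auto simp: orient_def)

text \<open>The proper coloring \<open>\<kappa>0\<close> directs every edge, so strict increase
  along its orientation settles the comparison of colors on every edge.\<close>

lemma orient_eq_iff:
  assumes "proper E \<kappa>0"
  shows "proper E \<kappa> \<and> orient E \<kappa> = orient E \<kappa>0 \<longleftrightarrow> (\<forall>(i,j)\<in>orient E \<kappa>0. \<kappa> i < \<kappa> j)"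
proof
  assume "proper E \<kappa> \<and> orient E \<kappa> = orient E \<kappa>0"
  then show "\<forall>(i,j)\<in>orient E \<kappa>0. \<kappa> i < \<kappa> j" by (auto simp: orient_def)
next
  assume *: "\<forall>(i,j)\<in>orient E \<kappa>0. \<kappa> i < \<kappa> j"
  have ne: "\<kappa>0 i \<noteq> \<kappa>0 j" if "(i, j) \<in># E" for i j
    using assms that by (auto simp: proper_def)
  have lt: "\<kappa> i < \<kappa> j" if "\<kappa>0 i < \<kappa>0 j" "(i, j) \<in># E \<or> (j, i) \<in># E" for i j
    using * that by (auto simp: orient_def)
  have "\<kappa> i < \<kappa> j \<longleftrightarrow> \<kappa>0 i < \<kappa>0 j" if "(i, j) \<in># E \<or> (j, i) \<in># E" for i j
    using that ne[of i j] ne[of j i] lt[of i j] lt[of j i] by (meson nat_neq_iff less_asym)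
  moreover have "\<kappa> i \<noteq> \<kappa> j" if "(i, j) \<in># E" for i j
    using that ne[OF that] lt[of i j] lt[of j i] by (cases "\<kappa>0 i < \<kappa>0 j") auto
  ultimately show "proper E \<kappa> \<and> orient E \<kappa> = orient E \<kappa>0"
    by (auto simp: orient_def proper_def)
qed

lemma decreasing_labelling:
  fixes \<kappa> :: "nat \<Rightarrow> nat"
  shows "\<exists>g :: nat \<Rightarrow> nat. inj_on g {1..n} \<and> (\<forall>i\<in>{1..n}. \<forall>j\<in>{1..n}. \<kappa> i < \<kappa> j \<longrightarrow> g j < g i)"
proof -
  let ?M = "Max (\<kappa> ` {1..n})"
  \<comment> \<open>Two digits in base \<open>n + 1\<close>: the leading digit reverses the order of
    the colors, the trailing digit \<open>i \<le> n\<close> keeps labels distinct.\<close>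
  let ?g = "\<lambda>i. (?M - \<kappa> i) * Suc n + i"
  have "?g i mod Suc n = i" if "i \<in> {1..n}" for i
    using that by (metis atLeastAtMost_iff le_imp_less_Suc mod_less mod_mult_self3)
  then have "inj_on ?g {1..n}" by (metis (no_types, lifting) inj_onI)
  moreover have "?g j < ?g i" if ij: "i \<in> {1..n}" "j \<in> {1..n}" "\<kappa> i < \<kappa> j" for i j
  proof -
    have "\<kappa> j \<le> ?M" using ij by simp
    then have "Suc (?M - \<kappa> j) \<le> ?M - \<kappa> i" using ij by linarith
    then have "Suc (?M - \<kappa> j) * Suc n \<le> (?M - \<kappa> i) * Suc n" by (rule mult_le_mono1)
    moreover have "Suc k * Suc n \<le> l \<Longrightarrow> k * Suc n + j < l + i" for k l
      using ij by simp
    ultimately show ?thesis by blast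
  qed
  ultimately show ?thesis by blast
qed

lemma XG_orient:
  assumes RR: "RR = orient E ` {\<kappa>\<in>seqs n. proper E \<kappa>}" "finite RR"
  shows "XG n E e = (\<Sum>R\<in>RR. monom 1 (orient_asc E R) *
    of_nat (card {\<kappa>\<in>seqs n. (\<forall>(i,j)\<in>R. \<kappa> i < \<kappa> j) \<and> monomial_of n \<kappa> = e}))"
proof -
  let ?K = "{\<kappa>\<in>seqs n. proper E \<kappa> \<and> monomial_of n \<kappa> = e}"
  have fin: "finite ?K" by (rule finite_subset[OF _ finite_seqs_monomial[of n e]]) auto
  have "XG n E e = (\<Sum>\<kappa>\<in>?K. monom 1 (orient_asc E (orient E \<kappa>)))"
    by (simp add: XG_def asc_orient)
  also have "\<dots> = (\<Sum>R\<in>RR. \<Sum>\<kappa>\<in>{\<kappa>\<in>?K. orient E \<kappa> = R}. monom 1 (orient_asc E (orient E \<kappa>)))"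
    by (rule sum.group[symmetric, OF fin RR(2)]) (auto simp: RR(1))
  also have "\<dots> = (\<Sum>R\<in>RR. monom 1 (orient_asc E R) *
    of_nat (card {\<kappa>\<in>seqs n. (\<forall>(i,j)\<in>R. \<kappa> i < \<kappa> j) \<and> monomial_of n \<kappa> = e}))"
  proof (rule sum.cong[OF refl])
    fix R assume "R \<in> RR"
    then obtain \<kappa>0 where "proper E \<kappa>0" and R: "R = orient E \<kappa>0" using RR(1) by auto
    then have "{\<kappa>\<in>?K. orient E \<kappa> = R}
        = {\<kappa>\<in>seqs n. (\<forall>(i,j)\<in>R. \<kappa> i < \<kappa> j) \<and> monomial_of n \<kappa> = e}"
      using orient_eq_iff[of E \<kappa>0] by blast
    then have "(\<Sum>\<kappa>\<in>{\<kappa>\<in>?K. orient E \<kappa> = R}. monom 1 (orient_asc E R) :: rat poly) =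
      monom 1 (orient_asc E R) * of_nat (card {\<kappa>\<in>seqs n. (\<forall>(i,j)\<in>R. \<kappa> i < \<kappa> j) \<and> monomial_of n \<kappa> = e})"
      by (simp only: sum_constant mult.commute)
    moreover have "(\<Sum>\<kappa>\<in>{\<kappa>\<in>?K. orient E \<kappa> = R}. monom 1 (orient_asc E (orient E \<kappa>)) :: rat poly)
        = (\<Sum>\<kappa>\<in>{\<kappa>\<in>?K. orient E \<kappa> = R}. monom 1 (orient_asc E R))"
      by (rule sum.cong) auto
    ultimately show "(\<Sum>\<kappa>\<in>{\<kappa>\<in>?K. orient E \<kappa> = R}. monom 1 (orient_asc E (orient E \<kappa>)) :: rat poly) =
      monom 1 (orient_asc E R) * of_nat (card {\<kappa>\<in>seqs n. (\<forall>(i,j)\<in>R. \<kappa> i < \<kappa> j) \<and> monomial_of n \<kappa> = e})"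
      by (rule trans[rotated])
  qed
  finally show ?thesis .
qed

section \<open>Assembly of the two expansions\<close>

lemma Des_subset: "Des n g \<sigma> \<subseteq> {1..<n}"
  by (auto simp: Des_def)

text \<open>Linear extensions are collected by descent set. \<open>f\<close> is arbitrary so that
  the same coefficients serve the fundamental functions and their images under \<omega>.\<close>

lemma sum_over_descent_sets:
  fixes w :: "'r \<Rightarrow> rat poly" and f :: "nat set \<Rightarrow> rat poly"
  assumes "\<And>R. R \<in> RR \<Longrightarrow> finite (LE R)"
  shows "(\<Sum>S\<in>Pow {1..<n}. (\<Sum>R\<in>RR. w R * of_nat (card {\<sigma>\<in>LE R. Des n (G R) \<sigma> = S})) * f S)
    = (\<Sum>R\<in>RR. w R * (\<Sum>\<sigma>\<in>LE R. f (Des n (G R) \<sigma>)))"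
proof -
  have "(\<Sum>S\<in>Pow {1..<n}. (\<Sum>R\<in>RR. w R * of_nat (card {\<sigma>\<in>LE R. Des n (G R) \<sigma> = S})) * f S)
    = (\<Sum>R\<in>RR. \<Sum>S\<in>Pow {1..<n}. w R * (of_nat (card {\<sigma>\<in>LE R. Des n (G R) \<sigma> = S}) * f S))"
    by (subst sum.swap) (simp add: sum_distrib_right mult.assoc)
  also have "\<dots> = (\<Sum>R\<in>RR. w R * (\<Sum>\<sigma>\<in>LE R. f (Des n (G R) \<sigma>)))"
  proof (rule sum.cong[OF refl])
    fix R assume "R \<in> RR"
    have "(\<Sum>S\<in>Pow {1..<n}. of_nat (card {\<sigma>\<in>LE R. Des n (G R) \<sigma> = S}) * f S)
      = (\<Sum>S\<in>Pow {1..<n}. \<Sum>\<sigma>\<in>{\<sigma>\<in>LE R. Des n (G R) \<sigma> = S}. f (Des n (G R) \<sigma>))"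
      by (rule sum.cong) auto
    also have "\<dots> = (\<Sum>\<sigma>\<in>LE R. f (Des n (G R) \<sigma>))"
      using Des_subset by (intro sum.group assms[OF \<open>R \<in> RR\<close>]) auto
    finally show "(\<Sum>S\<in>Pow {1..<n}. w R * (of_nat (card {\<sigma>\<in>LE R. Des n (G R) \<sigma> = S}) * f S))
      = w R * (\<Sum>\<sigma>\<in>LE R. f (Des n (G R) \<sigma>))"
      by (simp only: sum_distrib_left[symmetric])
  qed
  finally show ?thesis .
qed

text \<open>Weak inequalities compose along paths, so the condition on \<open>R\<close> becomes one
  on a preorder, as \<open>weak_expansion\<close> requires.\<close>

lemma weak_rtrancl_iff:
  assumes "R \<subseteq> {1..n} \<times> {1..n}"
  shows "(\<forall>(i,j)\<in>R. \<kappa> j \<le> (\<kappa> i :: nat)) \<longleftrightarrow>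
    (\<forall>i\<in>{1..n}. \<forall>j\<in>{1..n}. (i, j) \<in> (R\<inverse>)\<^sup>* \<longrightarrow> \<kappa> i \<le> \<kappa> j)" (is "?l \<longleftrightarrow> ?r")
proof
  assume l: ?l
  have "\<kappa> i \<le> \<kappa> j" if "(i, j) \<in> (R\<inverse>)\<^sup>*" for i j
    using that by induction (use l in \<open>auto intro: order.trans\<close>)
  then show ?r by blast
next
  assume ?r
  then show ?l using assms by blast
qed

text \<open>As \<omega> acts on the index of each fundamental function, it is expressed through
  \<open>a\<close>, an expansion of the chromatic function in these.\<close>

theorem theorem7p3:
  fixes n :: nat and E :: "(nat \<times> nat) multiset"
  assumes "\<forall>(i,j)\<in>#E. i \<in> {1..n} \<and> j \<in> {1..n} \<and> i \<noteq> j"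
  shows "\<exists>(a :: nat set \<Rightarrow> rat poly) (c :: nat list \<Rightarrow> rat poly).
           (\<forall>e. XG n E e = (\<Sum>S\<in>Pow {1..<n}. a S * qsF n S e))
         \<and> (\<forall>e. (\<Sum>S\<in>Pow {1..<n}. a S * qsF n (omega_set n S) e)
                 = (\<Sum>\<alpha>\<in>comps n. c \<alpha> * [: 1 / zee \<alpha> :] * Psi n \<alpha> e))
         \<and> (\<forall>\<alpha>\<in>comps n. \<forall>k. coeff (c \<alpha>) k \<in> \<nat>)"
proof -
  define RR where "RR = orient E ` {\<kappa>\<in>seqs n. proper E \<kappa>}"
  have sub: "R \<subseteq> {1..n} \<times> {1..n}" if "R \<in> RR" for R
    using that assms by (fastforce simp: RR_def orient_def)
  then have finRR: "finite RR"
    by (intro finite_subset[of RR "Pow ({1..n} \<times> {1..n})"]) auto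
  \<comment> \<open>A coloring that induces \<open>R\<close> increases along it, so labels that
    reverse the order of its colors decrease along \<open>R\<close>.\<close>
  have "\<forall>R\<in>RR. \<exists>g :: nat \<Rightarrow> nat. inj_on g {1..n} \<and> (\<forall>(i,j)\<in>R. g i > g j)"
  proof
    fix R assume R: "R \<in> RR"
    then obtain \<kappa>0 where \<kappa>0: "R = orient E \<kappa>0" by (auto simp: RR_def)
    obtain g :: "nat \<Rightarrow> nat" where "inj_on g {1..n}"
      and g: "\<forall>i\<in>{1..n}. \<forall>j\<in>{1..n}. \<kappa>0 i < \<kappa>0 j \<longrightarrow> g j < g i"
      using decreasing_labelling[of n \<kappa>0] by blast
    moreover have "\<forall>(i,j)\<in>R. g i > g j"
      using g sub[OF R] unfolding \<kappa>0 orient_def by blast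
    ultimately show "\<exists>g :: nat \<Rightarrow> nat. inj_on g {1..n} \<and> (\<forall>(i,j)\<in>R. g i > g j)" by blast
  qed
  from bchoice[OF this] obtain G :: "(nat \<times> nat) set \<Rightarrow> nat \<Rightarrow> nat"
    where "\<forall>R\<in>RR. inj_on (G R) {1..n} \<and> (\<forall>(i,j)\<in>R. G R i > G R j)" by blast
  then have G: "inj_on (G R) {1..n}" "\<forall>(i,j)\<in>R. G R i > G R j" if "R \<in> RR" for R
    using that by blast+
  define w where "w R = (monom 1 (orient_asc E R) :: rat poly)" for R
  \<comment> \<open>The converse enters because \<omega> replaces strict colorings along
    \<open>R\<close> by weak ones along \<open>R\<inverse>\<close>; its closure is the preorder to
    exhaust.\<close>
  define r where "r R = (\<lambda>i j. (i, j) \<in> ((R :: (nat \<times> nat) set)\<inverse>)\<^sup>*)" for R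
  define a where "a S = (\<Sum>R\<in>RR. w R * of_nat (card {\<sigma>\<in>linexts n R. Des n (G R) \<sigma> = S}))" for S
  define c where "c \<alpha> = (\<Sum>R\<in>RR. w R * of_nat (exhaustions (r R) (rev \<alpha>) {1..n}))" for \<alpha>
  have perms: "linexts n R \<subseteq> perms n" for R by (auto simp: linexts_def)
  have fin: "finite (linexts n R)" for R using finite_subset[OF perms finite_perms] .
  have "XG n E e = (\<Sum>S\<in>Pow {1..<n}. a S * qsF n S e)" for e
  proof -
    have "(\<Sum>S\<in>Pow {1..<n}. a S * qsF n S e)
      = (\<Sum>R\<in>RR. w R * (\<Sum>\<sigma>\<in>linexts n R. qsF n (Des n (G R) \<sigma>) e))"
      unfolding a_def by (rule sum_over_descent_sets) (rule fin)
    also have "\<dots> = (\<Sum>R\<in>RR. w R *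
        of_nat (card {\<kappa>\<in>seqs n. (\<forall>(i,j)\<in>R. \<kappa> i < \<kappa> j) \<and> monomial_of n \<kappa> = e}))"
    proof (rule sum.cong[OF refl])
      fix R assume R: "R \<in> RR"
      show "w R * (\<Sum>\<sigma>\<in>linexts n R. qsF n (Des n (G R) \<sigma>) e) = w R *
        of_nat (card {\<kappa>\<in>seqs n. (\<forall>(i,j)\<in>R. \<kappa> i < \<kappa> j) \<and> monomial_of n \<kappa> = e})"
        by (subst card_linexts[OF G(1)[OF R] linexts_strict_iff[OF sub[OF R] G(2)[OF R]] perms]) auto
    qed
    also have "\<dots> = XG n E e"
      using XG_orient[OF RR_def finRR, of e] by (simp only: w_def)
    finally show ?thesis by simp
  qed
  moreover have "(\<Sum>S\<in>Pow {1..<n}. a S * qsF n (omega_set n S) e)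
                 = (\<Sum>\<alpha>\<in>comps n. c \<alpha> * [: 1 / zee \<alpha> :] * Psi n \<alpha> e)" for e
  proof -
    have "(\<Sum>S\<in>Pow {1..<n}. a S * qsF n (omega_set n S) e)
      = (\<Sum>R\<in>RR. w R * (\<Sum>\<sigma>\<in>linexts n R. qsF n (omega_set n (Des n (G R) \<sigma>)) e))"
      unfolding a_def by (rule sum_over_descent_sets) (rule fin)
    also have "\<dots> = (\<Sum>R\<in>RR. w R *
        (\<Sum>\<alpha>\<in>comps n. of_nat (exhaustions (r R) (rev \<alpha>) {1..n}) * [:1 / zee \<alpha>:] * Psi n \<alpha> e))"
    proof (rule sum.cong[OF refl])
      fix R assume R: "R \<in> RR"
      have "reflp (r R)" "transp (r R)"
        unfolding r_def by (auto simp: reflp_def intro!: transpI elim: rtrancl_trans)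
      note weak_expansion[OF this, of n e, symmetric]
      \<comment> \<open>Reversed words are linear extensions of the converse, and these account for
        the colorings that weakly decrease along \<open>R\<close>.\<close>
      moreover have "(\<Sum>\<sigma>\<in>linexts n R. qsF n (omega_set n (Des n (G R) \<sigma>)) e)
        = of_nat (card {\<kappa>\<in>seqs n. (\<forall>(i,j)\<in>R. \<kappa> j \<le> \<kappa> i) \<and> monomial_of n \<kappa> = e})"
        unfolding sum_linexts_omega[OF G(1)[OF R]]
        using card_linexts[OF G(1)[OF R] linexts_weak_iff[OF sub[OF R] G(2)[OF R]] perms] by simp
      ultimately show "w R * (\<Sum>\<sigma>\<in>linexts n R. qsF n (omega_set n (Des n (G R) \<sigma>)) e) = w R *
        (\<Sum>\<alpha>\<in>comps n. of_nat (exhaustions (r R) (rev \<alpha>) {1..n}) * [:1 / zee \<alpha>:] * Psi n \<alpha> e)"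
        by (simp only: weak_rtrancl_iff[OF sub[OF R]] r_def)
    qed
    also have "\<dots> = (\<Sum>\<alpha>\<in>comps n. c \<alpha> * [: 1 / zee \<alpha> :] * Psi n \<alpha> e)"
      unfolding c_def sum_distrib_left sum_distrib_right by (subst sum.swap) (simp only: mult.assoc)
    finally show ?thesis .
  qed
  moreover have "coeff (c \<alpha>) k \<in> \<nat>" for \<alpha> k
  proof -
    \<comment> \<open>Each orientation puts its number of exhaustions in the single degree
      \<open>orient_asc E R\<close>.\<close>
    have "coeff (c \<alpha>) k =
        of_nat (\<Sum>R\<in>RR. if orient_asc E R = k then exhaustions (r R) (rev \<alpha>) {1..n} else 0)"
      unfolding c_def w_def coeff_sum of_nat_sum
      by (rule sum.cong) (auto simp: of_nat_poly smult_monom)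
    then show ?thesis by (simp only: of_nat_in_Nats)
  qed
  ultimately show ?thesis by blast
qed

end
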